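(* The two-sided left overlap division $\mathcal W$ is a Gröbner involutive division: for every field $R$, every admissible monomial ordering $O$ on $R\langle x_1,\dots,x_n\rangle$ and every finite set $G$ of nonzero polynomials that is a Locally Involutive Basis with respect to $\mathcal W$ and $O$, the set $G$ is a (noncommutative) Gröbner Basis, with respect to $O$, of the two-sided ideal it generates.
   Context: Monomials are words in the noncommuting variables $x_1,\dots,x_n$; a monomial ordering (total order on monomials) is admissible if $1<m$ for all $m\neq 1$ and $m_1<m_2$ implies $\ell m_1 r<\ell m_2 r$ for all monomials $\ell,r$. $\mathrm{LM},\mathrm{LC}$ denote leading monomial and coefficient. A weak involutive division (one that is not strong) is called Gröbner if every Locally Involutive Basis with respect to it is a Gröbner Basis. An involutive division is a rule $I$ assigning to every finite set $U$ of monomials and every $u\in U$ a set $\mathcal M^L_I(u,U)\subseteq\{x_1,\dots,x_n\}$ of left multiplicative variables and a set $\mathcal M^R_I(u,U)\subseteq\{x_1,\dots,x_n\}$ of right multiplicative variables. For $u\in U$ and a factorisation $w=v_1uv_2$, $u$ is an involutive divisor of $w$ at this factorisation if (thin divisors) the last letter of $v_1$ (if $v_1\ne1$) is in $\mathcal M^L_I(u,U)$ and the first letter of $v_2$ (if $v_2\neq1$) is in $\mathcal M^R_I(u,U)$. For a finite set $P$ of nonzero polynomials, multiplicative variables of $p\in P$ are those of $\mathrm{LM}(p)$ with respect to $U=\mathrm{LM}(P)$. Involutive reduction of $f$ by $P$: repeatedly take the leading term $c\,w$ of the current polynomial; if some $\mathrm{LM}(p)$, $p\in P$, involutively divides $w$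 at $w=v_1\mathrm{LM}(p)v_2$, subtract $c\,\mathrm{LC}(p)^{-1}v_1pv_2$; otherwise move $c\,w$ to the remainder. $f$ involutively reduces to zero using $P$ if the final remainder is $0$. $P$ is autoreduced if no $p\in P$ contains a term whose monomial is involutively divisible (multiplicative variables taken over $P$) by $\mathrm{LM}(p')$ for some $p'\in P\setminus\{p\}$. A left (right) prolongation of $p\in P$ is $x_ip$ with $x_i\notin\mathcal M^L_I(\mathrm{LM}(p),\mathrm{LM}(P))$ (resp. $px_i$ with $x_i\notin\mathcal M^R_I(\mathrm{LM}(p),\mathrm{LM}(P))$). An autoreduced $P$ is a Locally Involutive Basis if all left and right prolongations of its elements involutively reduce to zero using $P$. DegRevLex ordering (with $x_1>x_2>\cdots>x_n$): $m_1<m_2$ if $\deg m_1<\deg m_2$, or the degrees are equal and, reading from right to left, at the first position where the words differ the letter of $m_1$ is greater than that of $m_2$. Two-sided left overlap division $\mathcal W$. Let $U=\{u_1,\dots,u_m\}$ be a finite set of monomials listed so that $u_1>u_2>\cdots>u_m$ in DegRevLex. Start with all variables left and right multiplicative for all $u_i$. For $i=1,\dots,m$ and, for each $i$, for $j=i,i+1,\dots,m$, with $u_i=x_{i_1}\cdots x_{i_\alpha}$ and $u_j=x_{j_1}\cdots x_{j_\beta}$, do: (1) if $i\ne j$, then for each $1\le k\le\alpha-\beta+1$ with $x_{i_k}\cdots x_{i_{k+\beta-1}}=u_j$: if $k<\alpha-\beta+1$ make $x_{i_{k+\beta}}$ right nonmultiplicative for $u_j$, and if $k=\alpha-\beta+1$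 make $x_{i_{k-1}}$ left nonmultiplicative for $u_j$; (2) for $k=1,\dots,\beta-1$ in order: if the prefix of $u_i$ of length $k$ equals the suffix of $u_j$ of length $k$, and currently $x_{j_{\beta-k}}$ is left multiplicative for $u_i$ and $x_{i_{k+1}}$ is right multiplicative for $u_j$, make $x_{i_{k+1}}$ right nonmultiplicative for $u_j$; then, if the suffix of $u_i$ of length $k$ equals the prefix of $u_j$ of length $k$, and currently $x_{j_{k+1}}$ is right multiplicative for $u_i$ and $x_{i_{\alpha-k}}$ is left multiplicative for $u_j$, make $x_{i_{\alpha-k}}$ left nonmultiplicative for $u_j$. *)

theory Defs
  imports "HOL-Library.Poly_Mapping" "HOL.Hull"
begin

section \<open>Noncommutative polynomials\<close>

text \<open>
  Monomials are words, i.e. lists over a finite, linearly ordered type of variables.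
  The multiplication of the monoid algebra \<^typ>\<open>'a \<Rightarrow>\<^sub>0 'k\<close> is written additively in
  the exponent monoid, so words are made an additive monoid under concatenation:
  \<open>0\<close> is the monomial $1$ and \<open>u + v\<close> is the monomial $uv$. With this instance
  \<open>'v list \<Rightarrow>\<^sub>0 'k\<close> is the free algebra over \<open>'k\<close> on the variables \<open>'v\<close>.
\<close>

instantiation list :: (type) monoid_add
begin

definition zero_list_def: "(0 :: 'a list) = []"
definition plus_list_def: "(u :: 'a list) + v = u @ v"

instance by standard (simp_all add: zero_list_def plus_list_def)

end

type_synonym 'v word = "'v list"
type_synonym ('v, 'k) ncpoly = "'v word \<Rightarrow>\<^sub>0 'k"

abbreviation mon :: "'v word \<Rightarrow> ('v, 'k::field) ncpoly" where
  "mon u \<equiv> Poly_Mapping.single u 1"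

abbreviation var :: "'v \<Rightarrow> ('v, 'k::field) ncpoly" where
  "var x \<equiv> mon [x]"

abbreviation scale :: "'k \<Rightarrow> ('v, 'k::field) ncpoly \<Rightarrow> ('v, 'k) ncpoly" where
  "scale c p \<equiv> Poly_Mapping.single [] c * p"

text \<open>A monomial ordering is given by its strict part.\<close>

definition admissible :: "('v word \<Rightarrow> 'v word \<Rightarrow> bool) \<Rightarrow> bool" where
  "admissible lt \<longleftrightarrow>
     (\<forall>u. \<not> lt u u) \<and>
     (\<forall>u v w. lt u v \<longrightarrow> lt v w \<longrightarrow> lt u w) \<and>
     (\<forall>u v. u \<noteq> v \<longrightarrow> lt u v \<or> lt v u) \<and>
     (\<forall>u. u \<noteq> [] \<longrightarrow> lt [] u) \<and>
     (\<forall>u v l r. lt u v \<longrightarrow> lt (l @ u @ r) (l @ v @ r))"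

text \<open>The leading monomial and coefficient are only meaningful for nonzero polynomials.\<close>

definition LM :: "('v word \<Rightarrow> 'v word \<Rightarrow> bool) \<Rightarrow> ('v, 'k::field) ncpoly \<Rightarrow> 'v word" where
  "LM lt p = (THE m. m \<in> Poly_Mapping.keys p \<and>
                (\<forall>m' \<in> Poly_Mapping.keys p. m' \<noteq> m \<longrightarrow> lt m' m))"

definition LC :: "('v word \<Rightarrow> 'v word \<Rightarrow> bool) \<Rightarrow> ('v, 'k::field) ncpoly \<Rightarrow> 'k" where
  "LC lt p = Poly_Mapping.lookup p (LM lt p)"

definition two_sided_ideal :: "'a::ring_1 set \<Rightarrow> bool" where
  "two_sided_ideal J \<longleftrightarrow>
     0 \<in> J \<and> (\<forall>f\<in>J. \<forall>g\<in>J. f + g \<in> J) \<and> (\<forall>f\<in>J. \<forall>a. a * f \<in> J \<and> f * a \<in> J)"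

definition ideal_generated :: "'a::ring_1 set \<Rightarrow> 'a set" where
  "ideal_generated G = two_sided_ideal hull G"

definition groebner_basis ::
  "('v word \<Rightarrow> 'v word \<Rightarrow> bool) \<Rightarrow> ('v, 'k::field) ncpoly set \<Rightarrow> ('v, 'k) ncpoly set \<Rightarrow> bool" where
  "groebner_basis lt G J \<longleftrightarrow>
     ideal_generated G = J \<and>
     (\<forall>f\<in>J. f \<noteq> 0 \<longrightarrow> (\<exists>g\<in>G. g \<noteq> 0 \<and> (\<exists>l r. LM lt f = l @ LM lt g @ r)))"

section \<open>Involutive divisions\<close>

text \<open>
  An involutive division maps \<open>U\<close> and \<open>u \<in> U\<close> to the pair of the sets of left and right
  multiplicative variables of \<open>u\<close>; its values at \<open>u \<notin> U\<close> or infinite \<open>U\<close> are irrelevant.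
\<close>

type_synonym 'v mult_vars = "'v word \<Rightarrow> 'v set \<times> 'v set"
type_synonym 'v inv_division = "'v word set \<Rightarrow> 'v mult_vars"

definition left_mult :: "'v mult_vars \<Rightarrow> 'v word \<Rightarrow> 'v set" where
  "left_mult M u = fst (M u)"

definition right_mult :: "'v mult_vars \<Rightarrow> 'v word \<Rightarrow> 'v set" where
  "right_mult M u = snd (M u)"

text \<open>\<open>u\<close> is an involutive divisor of \<open>v1 @ u @ v2\<close> at this factorisation (thin divisors).\<close>

definition inv_divides_at :: "'v mult_vars \<Rightarrow> 'v word \<Rightarrow> 'v word \<Rightarrow> 'v word \<Rightarrow> bool" where
  "inv_divides_at M v1 u v2 \<longleftrightarrow>
     (v1 \<noteq> [] \<longrightarrow> last v1 \<in> left_mult M u) \<and> (v2 \<noteq> [] \<longrightarrow> hd v2 \<in> right_mult M u)"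

definition inv_divides :: "'v mult_vars \<Rightarrow> 'v word \<Rightarrow> 'v word \<Rightarrow> bool" where
  "inv_divides M u w \<longleftrightarrow> (\<exists>v1 v2. w = v1 @ u @ v2 \<and> inv_divides_at M v1 u v2)"

text \<open>
  One step of involutive reduction. A state \<open>(f, r)\<close> consists of the current polynomial and
  the remainder collected so far. The choice of the divisor and of the factorisation is left
  open.
\<close>

inductive inv_red_step ::
  "'v inv_division \<Rightarrow> ('v word \<Rightarrow> 'v word \<Rightarrow> bool) \<Rightarrow> ('v, 'k::field) ncpoly set \<Rightarrow>
   ('v, 'k) ncpoly \<times> ('v, 'k) ncpoly \<Rightarrow> ('v, 'k) ncpoly \<times> ('v, 'k) ncpoly \<Rightarrow> bool"
  for I lt P where
  reduce:
    "\<lbrakk>f \<noteq> 0; p \<in> P; LM lt f = v1 @ LM lt p @ v2;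
      inv_divides_at (I (LM lt ` P)) v1 (LM lt p) v2\<rbrakk>
     \<Longrightarrow> inv_red_step I lt P (f, r)
           (f - scale (LC lt f * inverse (LC lt p)) (mon v1 * p * mon v2), r)"
| move:
    "\<lbrakk>f \<noteq> 0; \<forall>p\<in>P. \<not> inv_divides (I (LM lt ` P)) (LM lt p) (LM lt f)\<rbrakk>
     \<Longrightarrow> inv_red_step I lt P (f, r)
           (f - Poly_Mapping.single (LM lt f) (LC lt f),
            r + Poly_Mapping.single (LM lt f) (LC lt f))"

text \<open>Some run of the reduction process, started at \<open>f\<close>, ends with remainder \<open>0\<close>.\<close>

definition inv_reduces_to_zero ::
  "'v inv_division \<Rightarrow> ('v word \<Rightarrow> 'v word \<Rightarrow> bool) \<Rightarrow> ('v, 'k::field) ncpoly set \<Rightarrow>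
   ('v, 'k) ncpoly \<Rightarrow> bool" where
  "inv_reduces_to_zero I lt P f \<longleftrightarrow> (inv_red_step I lt P)\<^sup>*\<^sup>* (f, 0) (0, 0)"

definition autoreduced ::
  "'v inv_division \<Rightarrow> ('v word \<Rightarrow> 'v word \<Rightarrow> bool) \<Rightarrow> ('v, 'k::field) ncpoly set \<Rightarrow> bool" where
  "autoreduced I lt P \<longleftrightarrow>
     (\<forall>p\<in>P. \<forall>w \<in> Poly_Mapping.keys p. \<forall>p' \<in> P - {p}.
        \<not> inv_divides (I (LM lt ` P)) (LM lt p') w)"

definition locally_involutive_basis ::
  "'v inv_division \<Rightarrow> ('v word \<Rightarrow> 'v word \<Rightarrow> bool) \<Rightarrow> ('v, 'k::field) ncpoly set \<Rightarrow> bool" where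
  "locally_involutive_basis I lt P \<longleftrightarrow>
     autoreduced I lt P \<and>
     (\<forall>p\<in>P. \<forall>x. x \<notin> left_mult (I (LM lt ` P)) (LM lt p) \<longrightarrow>
        inv_reduces_to_zero I lt P (var x * p)) \<and>
     (\<forall>p\<in>P. \<forall>x. x \<notin> right_mult (I (LM lt ` P)) (LM lt p) \<longrightarrow>
        inv_reduces_to_zero I lt P (p * var x))"

section \<open>The two-sided left overlap division\<close>

text \<open>
  The order of the type \<open>'v\<close> is the order of the variables, i.e. $x_1$ is the greatest
  and $x_n$ the least element of \<open>'v\<close>.
\<close>

definition degrevlex_less :: "'v::linorder word \<Rightarrow> 'v word \<Rightarrow> bool" where
  "degrevlex_less u v \<longleftrightarrow>
     length u < length v \<or>
     length u = length v \<and>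
       (\<exists>k < length u. u ! k > v ! k \<and> (\<forall>j. k < j \<and> j < length u \<longrightarrow> u ! j = v ! j))"

text \<open>The enumeration of a finite set of words in decreasing DegRevLex order.\<close>

definition degrevlex_list :: "'v::linorder word set \<Rightarrow> 'v word list" where
  "degrevlex_list U = (THE us. set us = U \<and> sorted_wrt (\<lambda>u v. degrevlex_less v u) us)"

definition make_left_nonmult :: "'v \<Rightarrow> 'v word \<Rightarrow> 'v mult_vars \<Rightarrow> 'v mult_vars" where
  "make_left_nonmult x u M = M(u := (left_mult M u - {x}, right_mult M u))"

definition make_right_nonmult :: "'v \<Rightarrow> 'v word \<Rightarrow> 'v mult_vars \<Rightarrow> 'v mult_vars" where
  "make_right_nonmult x u M = M(u := (left_mult M u, right_mult M u - {x}))"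

text \<open>
  In the following the positions \<open>k\<close> are counted from 1, whereas \<open>!\<close> counts from 0; so
  \<open>ui ! (k + \<beta> - 1)\<close> is the letter at position \<open>k + \<beta>\<close>, and so on. The words occur in the
  order \<open>ui \<ge> uj\<close>, hence \<open>\<beta> \<le> \<alpha>\<close>.
\<close>

definition subword_step :: "'v word \<Rightarrow> 'v word \<Rightarrow> 'v mult_vars \<Rightarrow> 'v mult_vars" where
  "subword_step ui uj =
     (let \<alpha> = length ui; \<beta> = length uj in
      fold (\<lambda>k M.
        if take \<beta> (drop (k - 1) ui) = uj then
          if k < \<alpha> + 1 - \<beta> then make_right_nonmult (ui ! (k + \<beta> - 1)) uj M
          else make_left_nonmult (ui ! (k - 2)) uj M
        else M) [1..<\<alpha> + 2 - \<beta>])"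

definition prefix_suffix_step ::
  "'v word \<Rightarrow> 'v word \<Rightarrow> nat \<Rightarrow> 'v mult_vars \<Rightarrow> 'v mult_vars" where
  "prefix_suffix_step ui uj k M =
     (let \<beta> = length uj in
      if take k ui = drop (\<beta> - k) uj \<and>
         uj ! (\<beta> - k - 1) \<in> left_mult M ui \<and> ui ! k \<in> right_mult M uj
      then make_right_nonmult (ui ! k) uj M else M)"

definition suffix_prefix_step ::
  "'v word \<Rightarrow> 'v word \<Rightarrow> nat \<Rightarrow> 'v mult_vars \<Rightarrow> 'v mult_vars" where
  "suffix_prefix_step ui uj k M =
     (let \<alpha> = length ui in
      if drop (\<alpha> - k) ui = take k uj \<and>
         uj ! k \<in> right_mult M ui \<and> ui ! (\<alpha> - k - 1) \<in> left_mult M uj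
      then make_left_nonmult (ui ! (\<alpha> - k - 1)) uj M else M)"

definition overlap_step :: "'v word \<Rightarrow> 'v word \<Rightarrow> 'v mult_vars \<Rightarrow> 'v mult_vars" where
  "overlap_step ui uj =
     fold (\<lambda>k M. suffix_prefix_step ui uj k (prefix_suffix_step ui uj k M)) [1..<length uj]"

definition left_overlap_division :: "'v::linorder inv_division" where
  "left_overlap_division U =
     (let us = degrevlex_list U; m = length us in
      fold (\<lambda>i. fold (\<lambda>j M.
          overlap_step (us ! i) (us ! j)
            (if i \<noteq> j then subword_step (us ! i) (us ! j) M else M))
        [i..<m]) [0..<m] (\<lambda>_. (UNIV, UNIV)))"

text \<open>The list in the definition of \<^const>\<open>degrevlex_list\<close> exists and is unique.\<close>

lemma degrevlex_less_irrefl: "\<not> degrevlex_less u u"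
  by (auto simp: degrevlex_less_def)

lemma degrevlex_less_trans:
  assumes "degrevlex_less u v" "degrevlex_less v w"
  shows "degrevlex_less u w"
proof (cases "length u = length v \<and> length v = length w")
  case True
  from assms(1) True obtain k where k: "k < length u" "u ! k > v ! k"
    "\<forall>j. k < j \<and> j < length u \<longrightarrow> u ! j = v ! j"
    by (auto simp: degrevlex_less_def)
  from assms(2) True obtain l where l: "l < length u" "v ! l > w ! l"
    "\<forall>j. l < j \<and> j < length u \<longrightarrow> v ! j = w ! j"
    by (auto simp: degrevlex_less_def)
  have "u ! max k l > w ! max k l"
    using k l by (cases k l rule: linorder_cases) (auto simp: max_def)
  moreover have "\<forall>j. max k l < j \<and> j < length u \<longrightarrow> u ! j = w ! j"
    using k l by auto
  ultimately show ?thesis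
    using True k(1) l(1) unfolding degrevlex_less_def by (metis max_def)
next
  case False
  then show ?thesis using assms by (auto simp: degrevlex_less_def)
qed

lemma degrevlex_less_total:
  assumes "u \<noteq> v"
  shows "degrevlex_less u v \<or> degrevlex_less v u"
proof (cases "length u = length v")
  case True
  define D where "D = {k. k < length u \<and> u ! k \<noteq> v ! k}"
  have "finite D" "D \<noteq> {}"
    using assms True by (auto simp: D_def list_eq_iff_nth_eq)
  then have "Max D \<in> D" and "\<forall>j \<in> D. j \<le> Max D"
    by auto
  then have "Max D < length u" "u ! Max D \<noteq> v ! Max D"
    "\<forall>j. Max D < j \<and> j < length u \<longrightarrow> u ! j = v ! j"
    unfolding D_def by (auto simp: not_le[symmetric])
  then show ?thesis
    using True unfolding degrevlex_less_def by (metis linorder_neqE)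
next
  case False
  then show ?thesis by (auto simp: degrevlex_less_def)
qed

lemma degrevlex_list_ex1:
  assumes "finite U"
  shows "\<exists>!us. set us = U \<and> sorted_wrt (\<lambda>u v. degrevlex_less v u) us"
proof -
  define le where "le u v \<longleftrightarrow> u = v \<or> degrevlex_less v u" for u v :: "'a list"
  define lt where "lt u v \<longleftrightarrow> degrevlex_less v u" for u v :: "'a list"
  interpret D: linorder le lt
    by standard
      (auto simp: le_def lt_def degrevlex_less_irrefl
        dest: degrevlex_less_trans degrevlex_less_total degrevlex_less_irrefl[THEN notE])
  have "\<exists>!us. set us = U \<and> sorted_wrt lt us"
    using D.ex1_sorted_list_for_set_if_finite[OF assms] by (simp add: conj_commute)
  then show ?thesis
    unfolding lt_def .
qed

end

theory Submission
  imports Defs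
begin

text \<open>
  Every occurrence of a leading monomial \<open>u\<close> in a word \<open>w = l u r\<close> gives a multiple of a basis
  element with leading monomial \<open>w\<close>. If for each \<open>w\<close> all these multiples (made monic) agree up to
  multiples with leading monomials below \<open>w\<close>, then the basis is a Groebner basis, because admissible
  orderings are well-founded. The first step in the reduction of a prolongation gives such a
  congruence. For \<open>\<W>\<close> the reducing leading monomial ends with the new letter if the prolongation
  is a right one and begins with it if the prolongation is a left one; otherwise it would be a
  subword of the leading monomial that is prolonged, and the rule for subwords would make a
  neighbouring letter nonmultiplicative.

  If \<open>w\<close> is itself a leading monomial, then right prolongations move an occurrence to the end of
  \<open>w\<close>, and left prolongations then lengthen it until it is all of \<open>w\<close>. If \<open>w\<close> is not a leading
  monomial, then by induction on the length of \<open>w\<close> only a prefix and a suffix that overlap have to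
  be compared, and the overlap rule lets one of them be prolonged towards the other.
\<close>

section \<open>The multiplicative variables of the division\<close>

definition mult_vars_le :: "'v mult_vars \<Rightarrow> 'v mult_vars \<Rightarrow> bool" where
  "mult_vars_le M M' \<longleftrightarrow>
     (\<forall>u. left_mult M u \<subseteq> left_mult M' u \<and> right_mult M u \<subseteq> right_mult M' u)"

definition shrinking :: "('v mult_vars \<Rightarrow> 'v mult_vars) \<Rightarrow> bool" where
  "shrinking f \<longleftrightarrow> (\<forall>M. mult_vars_le (f M) M)"

text \<open>The loops only ever remove multiplicative variables, so a property that is closed
  downwards survives every later step once it holds.\<close>

definition persistent :: "('v mult_vars \<Rightarrow> bool) \<Rightarrow> bool" where
  "persistent Q \<longleftrightarrow> (\<forall>M M'. mult_vars_le M M' \<longrightarrow> Q M' \<longrightarrow> Q M)"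

lemma mult_vars_le_refl: "mult_vars_le M M"
  by (simp add: mult_vars_le_def)

lemma mult_vars_le_trans: "mult_vars_le M M' \<Longrightarrow> mult_vars_le M' M'' \<Longrightarrow> mult_vars_le M M''"
  unfolding mult_vars_le_def by (meson subset_trans)

lemma mult_vars_le_make_nonmult:
  "mult_vars_le (make_left_nonmult x u M) M" "mult_vars_le (make_right_nonmult x u M) M"
  by (auto simp: mult_vars_le_def make_left_nonmult_def make_right_nonmult_def
      left_mult_def right_mult_def)

lemma left_mult_make_left_nonmult: "x \<notin> left_mult (make_left_nonmult x u M) u"
  by (simp add: make_left_nonmult_def left_mult_def)

lemma right_mult_make_right_nonmult: "x \<notin> right_mult (make_right_nonmult x u M) u"
  by (simp add: make_right_nonmult_def right_mult_def)

lemma shrinking_fold: "(\<And>x. x \<in> set xs \<Longrightarrow> shrinking (f x)) \<Longrightarrow> shrinking (fold f xs)"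
proof (induction xs)
  case Nil
  then show ?case by (simp add: shrinking_def mult_vars_le_refl)
next
  case (Cons x xs)
  then have "shrinking (f x)" "shrinking (fold f xs)" by auto
  then show ?case
    by (auto simp: shrinking_def intro: mult_vars_le_trans)
qed

lemma shrinking_comp: "shrinking f \<Longrightarrow> shrinking g \<Longrightarrow> shrinking (\<lambda>M. f (g M))"
  unfolding shrinking_def by (meson mult_vars_le_trans)

lemma persistentD: "persistent Q \<Longrightarrow> shrinking f \<Longrightarrow> Q M \<Longrightarrow> Q (f M)"
  unfolding persistent_def shrinking_def by blast

text \<open>The iteration at \<open>x\<close> forces \<open>Q\<close> from whatever state it meets,
  and later iterations only shrink the state. So no loop state ever has to be computed.\<close>

lemma fold_establishes:
  assumes "persistent Q" "\<And>x. x \<in> set xs \<Longrightarrow> shrinking (f x)"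
    and "x \<in> set xs" "\<And>M. Q (f x M)"
  shows "Q (fold f xs M)"
  using assms(2,3)
proof (induction xs arbitrary: M)
  case (Cons y ys)
  show ?case
  proof (cases "x \<in> set ys")
    case True
    then show ?thesis using Cons by simp
  next
    case False
    then have "x = y" using Cons.prems by simp
    then have "Q (f y M)" using assms(4) by simp
    moreover have "shrinking (fold f ys)" using Cons.prems by (intro shrinking_fold) simp
    ultimately show ?thesis using persistentD[OF assms(1)] by simp
  qed
qed simp

lemma persistent_left: "persistent (\<lambda>M. x \<notin> left_mult M u)"
  and persistent_right: "persistent (\<lambda>M. x \<notin> right_mult M u)"
  and persistent_disj: "persistent Q \<Longrightarrow> persistent R \<Longrightarrow> persistent (\<lambda>M. Q M \<or> R M)"
  unfolding persistent_def mult_vars_le_def by blast+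

section \<open>The single rules of the division\<close>

lemma shrinking_prefix_suffix_step: "shrinking (prefix_suffix_step u v k)"
  and shrinking_suffix_prefix_step: "shrinking (suffix_prefix_step u v k)"
  by (auto simp: shrinking_def prefix_suffix_step_def suffix_prefix_step_def Let_def
      mult_vars_le_refl mult_vars_le_make_nonmult)

lemma shrinking_prefix_suffix_suffix_prefix_step:
  "shrinking (\<lambda>M. suffix_prefix_step u v k (prefix_suffix_step u v k M))"
  by (rule shrinking_comp[OF shrinking_suffix_prefix_step shrinking_prefix_suffix_step])

lemma shrinking_overlap_step: "shrinking (overlap_step u v)"
  unfolding overlap_step_def
  by (rule shrinking_fold) (rule shrinking_prefix_suffix_suffix_prefix_step)

lemma shrinking_subword_step: "shrinking (subword_step u v)"
  unfolding subword_step_def Let_def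
  by (intro shrinking_fold)
    (auto simp: shrinking_def mult_vars_le_refl mult_vars_le_make_nonmult)

lemma subword_step_nonsuffix:
  assumes "u = a @ v @ x # b"
  shows "x \<notin> right_mult (subword_step u v M) v"
  unfolding subword_step_def Let_def
  \<comment> \<open>Positions count from 1, so the occurrence behind \<open>a\<close> has
    \<open>k = length a + 1\<close>; the letter \<open>x\<close> after it selects the nonsuffix
    branch.\<close>
  by (rule fold_establishes[OF persistent_right, where x = "Suc (length a)"])
    (auto simp: assms shrinking_def mult_vars_le_refl mult_vars_le_make_nonmult
      right_mult_make_right_nonmult nth_append)

lemma subword_step_suffix:
  assumes "u = a @ y # v"
  shows "y \<notin> left_mult (subword_step u v M) v"
  unfolding subword_step_def Let_def
  \<comment> \<open>The final occurrence starts at \<open>k = length a + 2\<close>, and index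
    \<open>k - 2\<close>, counted from 0, is that of the letter \<open>y\<close> before it.\<close>
  by (rule fold_establishes[OF persistent_left, where x = "Suc (Suc (length a))"])
    (auto simp: assms shrinking_def mult_vars_le_refl mult_vars_le_make_nonmult
      left_mult_make_left_nonmult nth_append)

text \<open>At \<open>k = length c\<close> the guard of the rule asks for exactly these two
  multiplicativities: if it fails, one of them is gone already, and if it holds, the rule removes
  \<open>x\<close>.\<close>

lemma overlap_step_prefix_suffix:
  assumes "u = c @ x # b" "v = a @ y # c" "c \<noteq> []"
  shows "x \<notin> right_mult (overlap_step u v M) v \<or> y \<notin> left_mult (overlap_step u v M) u"
  unfolding overlap_step_def
proof (rule fold_establishes[where x = "length c"])
  show "persistent (\<lambda>M. x \<notin> right_mult M v \<or> y \<notin> left_mult M u)"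
    by (intro persistent_disj persistent_left persistent_right)
next
  fix M :: "'a mult_vars"
  let ?Q = "\<lambda>M. x \<notin> right_mult M v \<or> y \<notin> left_mult M u"
  have "?Q (prefix_suffix_step u v (length c) M)"
    using assms right_mult_make_right_nonmult[of x v M]
    by (auto simp: prefix_suffix_step_def Let_def nth_append)
  then show "?Q (suffix_prefix_step u v (length c) (prefix_suffix_step u v (length c) M))"
    by (rule persistentD[OF _ shrinking_suffix_prefix_step, rotated])
      (intro persistent_disj persistent_left persistent_right)
qed (use assms in \<open>simp_all add: shrinking_prefix_suffix_suffix_prefix_step Suc_le_eq\<close>)

text \<open>Mirror image, for an overlap at the right end of \<open>u\<close>: when the guard holds,
  the rule now removes \<open>y\<close>.\<close>

lemma overlap_step_suffix_prefix:
  assumes "u = a @ y # c" "v = c @ x # b" "c \<noteq> []"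
  shows "x \<notin> right_mult (overlap_step u v M) u \<or> y \<notin> left_mult (overlap_step u v M) v"
  unfolding overlap_step_def
proof (rule fold_establishes[where x = "length c"])
  show "persistent (\<lambda>M. x \<notin> right_mult M u \<or> y \<notin> left_mult M v)"
    by (intro persistent_disj persistent_left persistent_right)
next
  fix M :: "'a mult_vars"
  let ?M = "prefix_suffix_step u v (length c) M"
  show "x \<notin> right_mult (suffix_prefix_step u v (length c) ?M) u \<or>
      y \<notin> left_mult (suffix_prefix_step u v (length c) ?M) v"
    using assms left_mult_make_left_nonmult[of y v ?M]
    by (auto simp: suffix_prefix_step_def Let_def nth_append)
qed (use assms in \<open>simp_all add: shrinking_prefix_suffix_suffix_prefix_step Suc_le_eq\<close>)

section \<open>From single rules to the whole division\<close>

lemma degrevlex_list: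
  assumes "finite U"
  shows "set (degrevlex_list U) = U"
    and "sorted_wrt (\<lambda>u v. degrevlex_less v u) (degrevlex_list U)"
  using theI'[OF degrevlex_list_ex1[OF assms]] by (simp_all add: degrevlex_list_def)

text \<open>Both nested loops shrink the state, so it suffices to look at the iteration for one pair
  \<open>i \<le> j\<close>.\<close>

lemma left_overlap_division_establishes:
  assumes "persistent Q" "i \<le> j" "j < length (degrevlex_list U)"
    and "\<And>M. Q (overlap_step (degrevlex_list U ! i) (degrevlex_list U ! j)
      (if i \<noteq> j then subword_step (degrevlex_list U ! i) (degrevlex_list U ! j) M else M))"
  shows "Q (left_overlap_division U)"
proof -
  let ?us = "degrevlex_list U"
  have shr: "shrinking (\<lambda>M. overlap_step (?us ! i) (?us ! j)
      (if i \<noteq> j then subword_step (?us ! i) (?us ! j) M else M))" for i j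
    by (rule shrinking_comp[OF shrinking_overlap_step])
      (use shrinking_subword_step in \<open>auto simp: shrinking_def mult_vars_le_refl\<close>)
  show ?thesis
    unfolding left_overlap_division_def Let_def
  proof (rule fold_establishes[OF assms(1), where x = i], goal_cases)
    case (1 k)
    show ?case by (rule shrinking_fold) (rule shr)
  next
    case 2
    show ?case using assms(2,3) by simp
  next
    case (3 M)
    show ?case
    proof (rule fold_establishes[OF assms(1), where x = j])
      show "j \<in> set [i..<length ?us]" using assms(2,3) by simp
    qed (rule shr, rule assms(4))
  qed
qed

text \<open>DegRevLex compares lengths first and the list is decreasing. Hence a proper subword is
  listed after the word that contains it, which is the order in which the subword rule visits the
  pair.\<close>

lemma degrevlex_list_length_less:
  assumes "i < length (degrevlex_list U)" "j < length (degrevlex_list U)" "finite U"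
    and "length (degrevlex_list U ! j) < length (degrevlex_list U ! i)"
  shows "i < j"
proof (rule ccontr)
  assume "\<not> i < j"
  moreover have "i \<noteq> j" using assms(4) by auto
  ultimately have "degrevlex_less (degrevlex_list U ! i) (degrevlex_list U ! j)"
    using sorted_wrt_nth_less[OF degrevlex_list(2)[OF assms(3)]] assms(1) by simp
  then show False using assms(4) by (auto simp: degrevlex_less_def)
qed

lemma degrevlex_list_nth:
  assumes "finite U" "u \<in> U"
  shows "\<exists>i < length (degrevlex_list U). degrevlex_list U ! i = u"
  using assms degrevlex_list(1)[of U] by (simp add: in_set_conv_nth[symmetric])

lemma left_overlap_division_nonsuffix:
  assumes "finite U" "v \<in> U" "a @ v @ x # b \<in> U"
  shows "x \<notin> right_mult (left_overlap_division U) v"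
proof -
  obtain i where i: "i < length (degrevlex_list U)" "degrevlex_list U ! i = a @ v @ x # b"
    using degrevlex_list_nth[OF assms(1,3)] by blast
  obtain j where j: "j < length (degrevlex_list U)" "degrevlex_list U ! j = v"
    using degrevlex_list_nth[OF assms(1,2)] by blast
  have "i < j" by (rule degrevlex_list_length_less[OF i(1) j(1) assms(1)]) (simp add: i j)
  then show ?thesis
    using subword_step_nonsuffix[OF i(2)]
    by (intro left_overlap_division_establishes[OF persistent_right _ j(1), of i])
      (simp_all add: j persistentD[OF persistent_right shrinking_overlap_step])
qed

lemma left_overlap_division_suffix:
  assumes "finite U" "v \<in> U" "a @ y # v \<in> U"
  shows "y \<notin> left_mult (left_overlap_division U) v"
proof -
  obtain i where i: "i < length (degrevlex_list U)" "degrevlex_list U ! i = a @ y # v"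
    using degrevlex_list_nth[OF assms(1,3)] by blast
  obtain j where j: "j < length (degrevlex_list U)" "degrevlex_list U ! j = v"
    using degrevlex_list_nth[OF assms(1,2)] by blast
  have "i < j" by (rule degrevlex_list_length_less[OF i(1) j(1) assms(1)]) (simp add: i j)
  then show ?thesis
    using subword_step_suffix[OF i(2)]
    by (intro left_overlap_division_establishes[OF persistent_left _ j(1), of i])
      (simp_all add: j persistentD[OF persistent_left shrinking_overlap_step])
qed

text \<open>The loops visit a pair only with the earlier word first. That order decides which
  overlap rule applies, but both rules give the same disjunction; \<open>i = j\<close> covers
  self-overlaps.\<close>

lemma left_overlap_division_overlap:
  assumes "finite U" "a @ y # c \<in> U" "c @ x # b \<in> U" "c \<noteq> []"
  shows "x \<notin> right_mult (left_overlap_division U) (a @ y # c) \<or>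
    y \<notin> left_mult (left_overlap_division U) (c @ x # b)"
proof -
  obtain i where i: "i < length (degrevlex_list U)" "degrevlex_list U ! i = a @ y # c"
    using degrevlex_list_nth[OF assms(1,2)] by blast
  obtain j where j: "j < length (degrevlex_list U)" "degrevlex_list U ! j = c @ x # b"
    using degrevlex_list_nth[OF assms(1,3)] by blast
  have pers: "persistent (\<lambda>M. x \<notin> right_mult M (a @ y # c) \<or> y \<notin> left_mult M (c @ x # b))"
    by (intro persistent_disj persistent_left persistent_right)
  show ?thesis
  proof (cases "i \<le> j")
    case True
    show ?thesis
      by (rule left_overlap_division_establishes[OF pers True j(1)], unfold i(2) j(2))
        (rule overlap_step_suffix_prefix[OF refl refl assms(4)])
  next
    case False
    then have "j \<le> i" by simp
    show ?thesis
      by (rule left_overlap_division_establishes[OF pers \<open>j \<le> i\<close> i(1)], unfold i(2) j(2))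
        (rule overlap_step_prefix_suffix[OF refl refl assms(4)])
  qed
qed

section \<open>Admissible orderings are well-founded\<close>

lemma admissible_irrefl: "admissible lt \<Longrightarrow> \<not> lt u u"
  by (simp add: admissible_def)

lemma admissible_trans: "admissible lt \<Longrightarrow> lt u v \<Longrightarrow> lt v w \<Longrightarrow> lt u w"
  unfolding admissible_def by meson

lemma admissible_total: "admissible lt \<Longrightarrow> u = v \<or> lt u v \<or> lt v u"
  unfolding admissible_def by meson

lemma admissible_Nil: "admissible lt \<Longrightarrow> u \<noteq> [] \<Longrightarrow> lt [] u"
  by (simp add: admissible_def)

lemma admissible_mono: "admissible lt \<Longrightarrow> lt u v \<Longrightarrow> lt (a @ u @ b) (a @ v @ b)"
  by (simp add: admissible_def)

text \<open>
  In a descending sequence that is chosen with minimal lengths, infinitely many words start with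
  the same letter \<open>x\<close>. Deleting this letter gives a descending sequence as well, so the first of
  these words could have been replaced by a shorter one.
\<close>

lemma admissible_wfP:
  fixes lt :: "'v::finite word \<Rightarrow> 'v word \<Rightarrow> bool"
  assumes adm: "admissible lt"
  shows "wfP lt"
proof (rule accp_wfpI, rule allI, rule ccontr)
  fix w0 :: "'v word"
  define Bad where "Bad = {w. \<not> Wellfounded.accp lt w}"
  assume "\<not> Wellfounded.accp lt w0"
  then have "w0 \<in> Bad" by (simp add: Bad_def)
  have below: "\<exists>v\<in>Bad. lt v w" if "w \<in> Bad" for w
    using that accp.intros[of lt w] unfolding Bad_def by blast
  \<comment> \<open>Coinduction for nonaccessible words: a set in which every word has a smaller one
    contains no accessible word.\<close>
  have Bad_coind: "Z \<subseteq> Bad" if Z: "\<And>v. v \<in> Z \<Longrightarrow> \<exists>v'\<in>Z. lt v' v" for Z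
  proof
    fix v assume "v \<in> Z"
    have "v \<notin> Z" if "Wellfounded.accp lt v" for v
      using that by (induction rule: accp.induct) (use Z in blast)
    then show "v \<in> Bad" using \<open>v \<in> Z\<close> by (auto simp: Bad_def)
  qed
  \<comment> \<open>A minimal bad sequence in the sense of Nash-Williams: each new word is a
    shortest bad word below the previous one.\<close>
  define next_word where
    "next_word w = arg_min length (\<lambda>v. v \<in> Bad \<and> lt v w)" for w :: "'v word"
  define s where "s = rec_nat (arg_min length (\<lambda>v. v \<in> Bad)) (\<lambda>_. next_word)"
  have s_Suc: "s (Suc n) = next_word (s n)" for n by (simp add: s_def)
  have next_word: "next_word w \<in> Bad \<and> lt (next_word w) w" if "w \<in> Bad" for w
    unfolding next_word_def using below[OF that] by (metis (mono_tags, lifting) arg_min_natI)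
  have s0: "s 0 \<in> Bad"
    using \<open>w0 \<in> Bad\<close> by (simp add: s_def) (metis arg_min_natI)
  have s_Bad: "s n \<in> Bad" for n
    by (induction n) (use s0 next_word s_Suc in auto)
  have s_desc: "lt (s (Suc n)) (s n)" for n
    using next_word[OF s_Bad] by (simp add: s_Suc)
  have s_less: "lt (s n) (s m)" if "m < n" for m n
    using that by (induction n) (metis less_Suc_eq s_desc admissible_trans[OF adm] not_less0)+
  \<comment> \<open>By transitivity, a bad word below \<open>s n\<close> was a candidate when
    \<open>s n\<close> was chosen.\<close>
  have s_min: "length (s n) \<le> length v"
    if "v \<in> Bad" "lt v (s n)" for n v
  proof (cases n)
    case 0
    then show ?thesis using that(1) arg_min_nat_le[of "\<lambda>v. v \<in> Bad" v length] by (simp add: s_def)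
  next
    case (Suc m)
    then have "lt v (s m)" using that(2) s_desc admissible_trans[OF adm] by blast
    then show ?thesis
      using that(1) arg_min_nat_le[of "\<lambda>v. v \<in> Bad \<and> lt v (s m)" v length] Suc
      by (simp add: s_Suc next_word_def)
  qed
  have s_ne: "s n \<noteq> []" for n
    using s_desc[of n] admissible_Nil[OF adm] admissible_irrefl[OF adm] admissible_trans[OF adm] by metis
  obtain n0 where "\<not> finite {n. hd (s n) = hd (s n0)}"
    using pigeonhole_infinite[of UNIV "\<lambda>n. hd (s n)"] by auto
  then have inf: "\<exists>n'>n. hd (s n') = hd (s n0)" for n
    by (auto simp: finite_nat_set_iff_bounded_le not_le)
  define Z where "Z = {tl (s n) | n. hd (s n) = hd (s n0)}"
  \<comment> \<open>Totality turns monotonicity into cancellation of a common first letter, so the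
    tails descend as well.\<close>
  have cancel: "lt v v'" if "lt (x # v) (x # v')" for x v v'
    using that admissible_total[OF adm, of v v'] admissible_mono[OF adm, of v' v "[x]" "[]"]
      admissible_irrefl[OF adm] admissible_trans[OF adm] by auto
  have "Z \<subseteq> Bad"
  proof (rule Bad_coind)
    fix v assume "v \<in> Z"
    then obtain n where n: "v = tl (s n)" "hd (s n) = hd (s n0)" by (auto simp: Z_def)
    obtain n' where n': "n' > n" "hd (s n') = hd (s n0)" using inf by blast
    have "lt (hd (s n0) # tl (s n')) (hd (s n0) # tl (s n))"
      using s_less[OF n'(1)] n n' s_ne by (metis list.collapse)
    then show "\<exists>v'\<in>Z. lt v' v" using n n' cancel by (auto simp: Z_def)
  qed
  then have "tl (s n0) \<in> Bad" by (auto simp: Z_def)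
  moreover have "lt (tl (s n0)) (s n0)"
    using admissible_mono[OF adm admissible_Nil[OF adm, of "[hd (s n0)]"], of "[]" "tl (s n0)"] s_ne[of n0]
    by simp
  ultimately have "length (s n0) \<le> length (tl (s n0))" by (rule s_min)
  then show False using s_ne[of n0] by (cases "s n0") auto
qed

section \<open>Polynomials as sums of terms\<close>

lemma ncpoly_sum_terms:
  "p = (\<Sum>k \<in> Poly_Mapping.keys p. Poly_Mapping.single k (Poly_Mapping.lookup p k))"
  by (rule poly_mapping_eqI)
    (simp add: lookup_sum lookup_single when_def sum.delta in_keys_iff)

lemma single_mult_single:
  "Poly_Mapping.single u c * Poly_Mapping.single v d = Poly_Mapping.single (u @ v) (c * d)"
  by (simp add: mult_single plus_list_def)

lemma mon_Nil [simp]: "Poly_Mapping.single [] 1 = (1 :: ('v, 'k::field) ncpoly)"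
  using single_one by (metis zero_list_def)

lemma mult_single_eq_scale:
  fixes p :: "('v, 'k::field) ncpoly"
  shows "p * Poly_Mapping.single r c = scale c p * mon r"
  by (subst (1 2) ncpoly_sum_terms[of p])
    (simp add: sum_distrib_left sum_distrib_right single_mult_single mult.commute)

lemma sandwich_sum_terms:
  fixes p :: "('v, 'k::field) ncpoly"
  shows "Poly_Mapping.single l c * p * mon r =
    (\<Sum>k \<in> Poly_Mapping.keys p. Poly_Mapping.single (l @ k @ r) (c * Poly_Mapping.lookup p k))"
  by (subst ncpoly_sum_terms[of p])
    (simp add: sum_distrib_left sum_distrib_right single_mult_single)

text \<open>Since \<open>l @ m @ r\<close> determines \<open>m\<close>, only one summand reaches
  this key.\<close>

lemma lookup_sandwich:
  fixes p :: "('v, 'k::field) ncpoly"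
  shows "Poly_Mapping.lookup (Poly_Mapping.single l c * p * mon r) (l @ m @ r) =
    c * Poly_Mapping.lookup p m"
  unfolding sandwich_sum_terms
  by (simp add: lookup_sum lookup_single when_def sum.delta in_keys_iff)

lemma keys_sandwich:
  fixes p :: "('v, 'k::field) ncpoly"
  assumes "k \<in> Poly_Mapping.keys (Poly_Mapping.single l c * p * mon r)"
  shows "\<exists>m \<in> Poly_Mapping.keys p. k = l @ m @ r"
proof (rule ccontr)
  assume "\<not> ?thesis"
  then have "Poly_Mapping.lookup (Poly_Mapping.single l c * p * mon r) k = 0"
    unfolding sandwich_sum_terms
    by (auto simp: lookup_sum lookup_single when_def intro!: sum.neutral)
  then show False using assms by (simp add: in_keys_iff)
qed

section \<open>Leading monomials and coefficients\<close>

lemma finite_has_greatest: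
  assumes "admissible lt" "finite A" "A \<noteq> {}"
  shows "\<exists>m\<in>A. \<forall>k\<in>A. k \<noteq> m \<longrightarrow> lt k m"
  using assms(2,3)
proof (induction rule: finite_ne_induct)
  case (insert x A)
  then obtain m where m: "m \<in> A" "\<forall>k\<in>A. k \<noteq> m \<longrightarrow> lt k m" by blast
  show ?case
  proof (cases "lt m x")
    case True
    then have "\<forall>k\<in>insert x A. k \<noteq> x \<longrightarrow> lt k x"
      using m admissible_trans[OF assms(1)] by (metis insert_iff)
    then show ?thesis by blast
  next
    case False
    then have "\<forall>k\<in>insert x A. k \<noteq> m \<longrightarrow> lt k m"
      using m admissible_total[OF assms(1), of x m] by auto
    then show ?thesis using m by blast
  qed
qed simp

lemma LM_eqI:
  assumes "admissible lt" "m \<in> Poly_Mapping.keys p"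
    and "\<And>k. k \<in> Poly_Mapping.keys p \<Longrightarrow> k \<noteq> m \<Longrightarrow> lt k m"
  shows "LM lt p = m"
  unfolding LM_def
proof (rule the_equality)
  fix m' assume "m' \<in> Poly_Mapping.keys p \<and>
    (\<forall>k \<in> Poly_Mapping.keys p. k \<noteq> m' \<longrightarrow> lt k m')"
  then show "m' = m"
    using assms admissible_irrefl[OF assms(1)] admissible_trans[OF assms(1)] by metis
qed (use assms in blast)

lemma LM_in_keys: "admissible lt \<Longrightarrow> p \<noteq> 0 \<Longrightarrow> LM lt p \<in> Poly_Mapping.keys p"
  and less_LM: "admissible lt \<Longrightarrow> k \<in> Poly_Mapping.keys p \<Longrightarrow> k \<noteq> LM lt p \<Longrightarrow> lt k (LM lt p)"
proof -
  have *: "LM lt p \<in> Poly_Mapping.keys p \<and>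
      (\<forall>k \<in> Poly_Mapping.keys p. k \<noteq> LM lt p \<longrightarrow> lt k (LM lt p))"
    if adm: "admissible lt" and ne: "Poly_Mapping.keys p \<noteq> {}" for p :: "('a, 'b) ncpoly"
  proof -
    obtain m where m: "m \<in> Poly_Mapping.keys p" "\<forall>k\<in>Poly_Mapping.keys p. k \<noteq> m \<longrightarrow> lt k m"
      using finite_has_greatest[OF adm _ ne] by auto
    then have "LM lt p = m" by (intro LM_eqI[OF adm]) auto
    then show ?thesis using m by simp
  qed
  show "admissible lt \<Longrightarrow> p \<noteq> 0 \<Longrightarrow> LM lt p \<in> Poly_Mapping.keys p" using * by simp
  show "admissible lt \<Longrightarrow> k \<in> Poly_Mapping.keys p \<Longrightarrow> k \<noteq> LM lt p \<Longrightarrow> lt k (LM lt p)" using * by blast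
qed

lemma LM_sandwich:
  assumes "admissible lt" "p \<noteq> 0" "c \<noteq> 0"
  shows "LM lt (Poly_Mapping.single l c * p * mon r) = l @ LM lt p @ r"
    and "LC lt (Poly_Mapping.single l c * p * mon r) = c * LC lt p"
    and "Poly_Mapping.single l c * p * mon r \<noteq> 0"
proof -
  have ne: "Poly_Mapping.lookup p (LM lt p) \<noteq> 0"
    using LM_in_keys[OF assms(1,2)] by (simp add: in_keys_iff)
  then have in_keys: "l @ LM lt p @ r \<in> Poly_Mapping.keys (Poly_Mapping.single l c * p * mon r)"
    by (simp add: in_keys_iff lookup_sandwich assms)
  then show LM: "LM lt (Poly_Mapping.single l c * p * mon r) = l @ LM lt p @ r"
    by (rule LM_eqI[OF assms(1)])
      (use keys_sandwich less_LM[OF assms(1)] admissible_mono[OF assms(1)] in blast)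
  show "LC lt (Poly_Mapping.single l c * p * mon r) = c * LC lt p"
    unfolding LC_def LM by (rule lookup_sandwich)
  show "Poly_Mapping.single l c * p * mon r \<noteq> 0" using in_keys by auto
qed

section \<open>Congruence below a monomial\<close>

locale ordered_generators =
  fixes lt :: "'v::{finite, linorder} word \<Rightarrow> 'v word \<Rightarrow> bool"
    and G :: "('v, 'k::field) ncpoly set"
  assumes adm: "admissible lt"
    and zero_notin: "0 \<notin> G"
    and inj_LM: "inj_on (LM lt) G"
begin

abbreviation U :: "'v word set" where
  "U \<equiv> LM lt ` G"

text \<open>By \<open>inj_LM\<close> a leading monomial determines its element, so the monic
  generators can be indexed by words; the value is meaningful only at words of
  \<open>U\<close>.\<close>

definition normed :: "'v word \<Rightarrow> ('v, 'k) ncpoly" where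
  "normed u = scale (inverse (LC lt (the_inv_into G (LM lt) u))) (the_inv_into G (LM lt) u)"

lemma LC_nonzero: "g \<in> G \<Longrightarrow> LC lt g \<noteq> 0"
  using LM_in_keys[OF adm, of g] zero_notin by (auto simp: LC_def in_keys_iff)

lemma normed_LM: "g \<in> G \<Longrightarrow> normed (LM lt g) = scale (inverse (LC lt g)) g"
  by (simp add: normed_def the_inv_into_f_f[OF inj_LM])

lemma eq_scale_normed:
  assumes "g \<in> G"
  shows "g = scale (LC lt g) (normed (LM lt g))"
  using LC_nonzero[OF assms]
  by (simp add: normed_LM[OF assms] mult.assoc[symmetric] single_mult_single)

lemma lookup_normed:
  assumes "u \<in> U"
  shows "Poly_Mapping.lookup (normed u) u = 1"
proof -
  obtain g where g: "g \<in> G" "u = LM lt g" using assms by blast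
  have "Poly_Mapping.lookup (normed u) u = inverse (LC lt g) * LC lt g"
    using lookup_sandwich[of "[]" "inverse (LC lt g)" g "[]" u] g by (simp add: normed_LM LC_def)
  then show ?thesis using LC_nonzero[OF g(1)] by simp
qed

lemma keys_normed:
  assumes "u \<in> U" "k \<in> Poly_Mapping.keys (normed u)" "k \<noteq> u"
  shows "lt k u"
proof -
  obtain g where g: "g \<in> G" "u = LM lt g" using assms by blast
  have "k \<in> Poly_Mapping.keys g"
    using keys_sandwich[of k "[]" "inverse (LC lt g)" g "[]"] assms(2) g by (auto simp: normed_LM)
  then show ?thesis using less_LM[OF adm] assms(3) g by blast
qed

definition shifted :: "'v word \<Rightarrow> 'v word \<Rightarrow> 'v word \<Rightarrow> ('v, 'k) ncpoly" where
  "shifted l u r = mon l * normed u * mon r"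

lemma sandwich_shifted:
  "Poly_Mapping.single a c * shifted l u r * mon b =
    scale c (shifted (a @ l) u (r @ b))"
proof -
  have "Poly_Mapping.single a c * shifted l u r * mon b =
      (Poly_Mapping.single a c * mon l) * normed u * (mon r * mon b)"
    by (simp only: shifted_def mult.assoc)
  also have "\<dots> = scale c (shifted (a @ l) u (r @ b))"
    by (simp add: shifted_def single_mult_single mult.assoc[symmetric])
  finally show ?thesis .
qed

text \<open>A bound on every summand of a representation before cancellation, which asks for more
  than a bound on the leading monomial of the sum.\<close>

inductive_set below :: "'v word \<Rightarrow> ('v, 'k) ncpoly set" for w where
  zero: "0 \<in> below w"
| add: "f \<in> below w \<Longrightarrow> u \<in> U \<Longrightarrow> lt (l @ u @ r) w \<Longrightarrow> f + scale c (shifted l u r) \<in> below w"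

lemma shifted_below: "u \<in> U \<Longrightarrow> lt (l @ u @ r) w \<Longrightarrow> scale c (shifted l u r) \<in> below w"
  using below.add[OF below.zero] by simp

lemma below_add: "f \<in> below w \<Longrightarrow> g \<in> below w \<Longrightarrow> f + g \<in> below w"
  by (rotate_tac, induction rule: below.induct)
    (auto simp: add.assoc[symmetric] intro: below.add)

lemma below_sandwich:
  assumes "f \<in> below w"
  shows "Poly_Mapping.single a c * f * mon b \<in> below (a @ w @ b)"
  using assms
proof (induction rule: below.induct)
  case zero
  show ?case by (simp add: below.zero)
next
  case (add f u l r d)
  have "Poly_Mapping.single a c * scale d (shifted l u r) * mon b =
      Poly_Mapping.single a (c * d) * shifted l u r * mon b"
    by (simp add: mult.assoc[symmetric] single_mult_single)
  then have eq: "Poly_Mapping.single a c * (f + scale d (shifted l u r)) * mon b =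
      Poly_Mapping.single a c * f * mon b + scale (c * d) (shifted (a @ l) u (r @ b))"
    by (simp add: distrib_left distrib_right sandwich_shifted)
  show ?case
    unfolding eq using add admissible_mono[OF adm add.hyps(3), of a b]
    by (intro below.add) auto
qed

lemma below_scale: "f \<in> below w \<Longrightarrow> scale c f \<in> below w"
  using below_sandwich[of f w "[]" c "[]"] by simp

lemma below_uminus: "f \<in> below w \<Longrightarrow> - f \<in> below w"
  using below_scale[of f w "-1"] by (simp add: single_uminus)

lemma below_diff: "f \<in> below w \<Longrightarrow> g \<in> below w \<Longrightarrow> f - g \<in> below w"
  using below_add[OF _ below_uminus] by fastforce

lemma below_sum: "(\<And>i. i \<in> A \<Longrightarrow> f i \<in> below w) \<Longrightarrow> sum f A \<in> below w"
  by (induction A rule: infinite_finite_induct) (auto intro: below.zero below_add)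

lemma below_mono: "f \<in> below w \<Longrightarrow> lt w w' \<Longrightarrow> f \<in> below w'"
  by (induction rule: below.induct) (auto intro: below.zero below.add admissible_trans[OF adm])

lemma keys_shifted:
  assumes "u \<in> U" "k \<in> Poly_Mapping.keys (shifted l u r)" "k \<noteq> l @ u @ r"
  shows "lt k (l @ u @ r)"
  using keys_sandwich[of k l 1 "normed u" r] assms keys_normed admissible_mono[OF adm]
  unfolding shifted_def by metis

lemma keys_scale: "Poly_Mapping.keys (scale c p) \<subseteq> Poly_Mapping.keys p"
  for p :: "('v, 'k) ncpoly"
  using keys_sandwich[of _ "[]" c p "[]"] by auto

lemma keys_below: "f \<in> below w \<Longrightarrow> k \<in> Poly_Mapping.keys f \<Longrightarrow> lt k w"
proof (induction rule: below.induct)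
  case (add f u l r c)
  then consider "k \<in> Poly_Mapping.keys f" | "k \<in> Poly_Mapping.keys (shifted l u r)"
    using keys_add[of f "scale c (shifted l u r)"] keys_scale by blast
  then show ?case
    using add keys_shifted admissible_trans[OF adm] by cases metis+
qed simp

definition cong_below :: "'v word \<Rightarrow> ('v, 'k) ncpoly \<Rightarrow> ('v, 'k) ncpoly \<Rightarrow> bool" where
  "cong_below w p q \<longleftrightarrow> p - q \<in> below w"

lemma cong_below_refl: "cong_below w p p"
  by (simp add: cong_below_def below.zero)

lemma cong_below_sym: "cong_below w p q \<Longrightarrow> cong_below w q p"
  using below_uminus[of "p - q" w] by (simp add: cong_below_def)

lemma cong_below_trans: "cong_below w p q \<Longrightarrow> cong_below w q s \<Longrightarrow> cong_below w p s"
  using below_add[of "p - q" w "q - s"] by (simp add: cong_below_def)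

lemma cong_below_shifted:
  assumes "cong_below w (shifted l u r) (shifted l' u' r')"
  shows "cong_below (a @ w @ b) (shifted (a @ l) u (r @ b)) (shifted (a @ l') u' (r' @ b))"
  using below_sandwich[OF assms[unfolded cong_below_def], of a 1 b]
  unfolding cong_below_def right_diff_distrib left_diff_distrib sandwich_shifted mon_Nil mult_1 .

text \<open>Buchberger's product criterion for words. In \<open>normed u * mon m * normed v\<close>,
  replacing one factor by its leading word gives the two multiples; each replacement costs multiples
  of the other generator by tail words, and these lie below.\<close>

lemma disjoint_cong:
  assumes "u \<in> U" "v \<in> U"
  shows "cong_below (l @ u @ m @ v @ r) (shifted l u (m @ v @ r)) (shifted (l @ u @ m) v r)"
proof -
  let ?N = normed
  \<comment> \<open>\<open>normed x\<close> has coefficient 1 at \<open>x\<close>, so the difference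
    is exactly its tail.\<close>
  have tail: "lt k x" if "x \<in> U" "k \<in> Poly_Mapping.keys (?N x - mon x)" for x k
  proof -
    have "k \<noteq> x" using that lookup_normed[OF that(1)] by (auto simp: in_keys_iff lookup_minus)
    then have "k \<in> Poly_Mapping.keys (?N x)"
      using that by (auto simp: in_keys_iff lookup_minus lookup_single)
    then show ?thesis using keys_normed that \<open>k \<noteq> x\<close> by blast
  qed
  have "(?N u - mon u) * mon m * ?N v =
      (\<Sum>k \<in> Poly_Mapping.keys (?N u - mon u).
        scale (Poly_Mapping.lookup (?N u - mon u) k) (shifted (k @ m) v []))"
    by (subst ncpoly_sum_terms[of "?N u - mon u"])
      (simp add: sum_distrib_right single_mult_single shifted_def mult.assoc[symmetric])
  also have "\<dots> \<in> below (u @ m @ v)"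
    using tail[OF assms(1)] admissible_mono[OF adm, of _ _ "[]" "m @ v"] assms
    by (intro below_sum shifted_below) auto
  finally have 1: "(?N u - mon u) * mon m * ?N v \<in> below (u @ m @ v)" .
  have right_term: "?N u * mon m * Poly_Mapping.single k c = scale c (shifted [] u (m @ k))" for k c
    by (subst mult_single_eq_scale) (simp add: shifted_def mult.assoc single_mult_single)
  have "?N u * mon m * (?N v - mon v) =
      (\<Sum>k \<in> Poly_Mapping.keys (?N v - mon v).
        scale (Poly_Mapping.lookup (?N v - mon v) k) (shifted [] u (m @ k)))"
    by (subst ncpoly_sum_terms[of "?N v - mon v"]) (simp only: sum_distrib_left right_term)
  also have "\<dots> \<in> below (u @ m @ v)"
    using tail[OF assms(2)] admissible_mono[OF adm, of _ _ "u @ m" "[]"] assms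
    by (intro below_sum shifted_below) auto
  finally have 2: "?N u * mon m * (?N v - mon v) \<in> below (u @ m @ v)" .
  have "shifted [] u (m @ v) - shifted (u @ m) v [] =
      ?N u * mon m * mon v - mon u * mon m * ?N v"
    by (simp add: shifted_def mult.assoc single_mult_single)
  also have "\<dots> = (?N u - mon u) * mon m * ?N v - ?N u * mon m * (?N v - mon v)"
    by (simp add: algebra_simps)
  finally have "cong_below (u @ m @ v) (shifted [] u (m @ v)) (shifted (u @ m) v [])"
    unfolding cong_below_def using below_diff[OF 1 2] by simp
  from cong_below_shifted[OF this, of l r] show ?thesis by simp
qed

section \<open>From confluence to divisibility of leading monomials\<close>

definition confluent_at :: "'v word \<Rightarrow> bool" where
  "confluent_at w \<longleftrightarrow>
     (\<forall>l u r l' u' r'. u \<in> U \<longrightarrow> u' \<in> U \<longrightarrow> w = l @ u @ r \<longrightarrow> w = l' @ u' @ r' \<longrightarrow>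
        cong_below w (shifted l u r) (shifted l' u' r'))"

lemma confluent_atD:
  "confluent_at w \<Longrightarrow> u \<in> U \<Longrightarrow> u' \<in> U \<Longrightarrow> w = l @ u @ r \<Longrightarrow> w = l' @ u' @ r' \<Longrightarrow>
    cong_below w (shifted l u r) (shifted l' u' r')"
  unfolding confluent_at_def by blast

text \<open>Summands with the same top word are merged into one: confluence exchanges their
  generators at the cost of multiples below. The coefficient \<open>c\<close> may become 0 when the
  tops cancel.\<close>

lemma below_leading_term:
  assumes conf: "\<And>w. confluent_at w" and "f \<in> below w" "f \<noteq> 0"
  shows "\<exists>l u r c h. u \<in> U \<and> lt (l @ u @ r) w \<and> h \<in> below (l @ u @ r) \<and>
    f = scale c (shifted l u r) + h"
  using assms(2,3)
proof (induction rule: below.induct)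
  case (add f v a b d)
  let ?t = "scale d (shifted a v b)"
  show ?case
  proof (cases "f = 0")
    case True
    then have "f + ?t = ?t + 0 \<and> 0 \<in> below (a @ v @ b)" by (simp add: below.zero)
    then show ?thesis using add.hyps by blast
  next
    case False
    then obtain l u r c h where IH: "u \<in> U" "lt (l @ u @ r) w" "h \<in> below (l @ u @ r)"
      "f = scale c (shifted l u r) + h" using add.IH by blast
    consider "lt (a @ v @ b) (l @ u @ r)" | "lt (l @ u @ r) (a @ v @ b)" | "a @ v @ b = l @ u @ r"
      using admissible_total[OF adm] by blast
    then show ?thesis
    proof cases
      case 1
      then have "h + ?t \<in> below (l @ u @ r)" using IH(3) add.hyps by (intro below.add)
      moreover have "f + ?t = scale c (shifted l u r) + (h + ?t)" by (simp add: IH(4) add.assoc)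
      ultimately show ?thesis using IH(1,2) by blast
    next
      case 2
      then have "f \<in> below (a @ v @ b)"
        unfolding IH(4) using IH(1,3) by (intro below_add shifted_below below_mono[OF IH(3)])
      moreover have "f + ?t = ?t + f" by (rule add.commute)
      ultimately show ?thesis using add.hyps(2,3) by blast
    next
      case 3
      have "cong_below (l @ u @ r) (shifted a v b) (shifted l u r)"
        by (rule confluent_atD[OF conf add.hyps(2) IH(1) 3[symmetric] refl])
      then have "scale d (shifted a v b - shifted l u r) \<in> below (l @ u @ r)"
        unfolding cong_below_def by (rule below_scale)
      then have "h + scale d (shifted a v b - shifted l u r) \<in> below (l @ u @ r)"
        using IH(3) below_add by blast
      moreover have "f + ?t = scale (c + d) (shifted l u r) +
          (h + scale d (shifted a v b - shifted l u r))"
        by (simp add: IH(4) single_add algebra_simps)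
      ultimately show ?thesis using IH(1,2) by blast
    qed
  qed
qed simp

text \<open>If the merged top coefficient vanishes, the bound drops to a smaller word and
  well-founded induction applies. Otherwise nothing can cancel the top term, so it is the leading
  one.\<close>

lemma confluent_LM:
  assumes conf: "\<And>w. confluent_at w" and "f \<in> below w" "f \<noteq> 0"
  shows "\<exists>g\<in>G. \<exists>l r. LM lt f = l @ LM lt g @ r"
  using admissible_wfP[OF adm] assms(2)
proof (induction w rule: wfp_induct_rule)
  case (less w)
  obtain l u r c h where *: "u \<in> U" "lt (l @ u @ r) w" "h \<in> below (l @ u @ r)"
    "f = scale c (shifted l u r) + h"
    using below_leading_term[OF conf less.prems assms(3)] by blast
  show ?case
  proof (cases "c = 0")
    case True
    then show ?thesis using less.IH[of "l @ u @ r"] * by simp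
  next
    case False
    have h: "Poly_Mapping.lookup h (l @ u @ r) = 0"
      using keys_below[OF *(3)] admissible_irrefl[OF adm] by (auto simp: in_keys_iff)
    have "Poly_Mapping.lookup (scale c (shifted l u r)) (l @ u @ r) = c"
      using lookup_sandwich[of l c "normed u" r u] lookup_normed[OF *(1)]
      by (simp add: shifted_def mult.assoc[symmetric] single_mult_single)
    then have "l @ u @ r \<in> Poly_Mapping.keys f"
      using False h by (simp add: *(4) in_keys_iff lookup_add)
    moreover have "lt k (l @ u @ r)" if "k \<in> Poly_Mapping.keys f" "k \<noteq> l @ u @ r" for k
      using that keys_add[of "scale c (shifted l u r)" h] keys_scale[of c "shifted l u r"]
        keys_shifted[OF *(1)] keys_below[OF *(3)] *(4) by blast
    ultimately have "LM lt f = l @ u @ r" by (rule LM_eqI[OF adm])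
    then show ?thesis using *(1) by blast
  qed
qed

end

section \<open>Involutive reduction to zero\<close>

context ordered_generators
begin

lemma cancel_LM:
  assumes "f \<noteq> 0" "p \<in> G" "LM lt f = a @ LM lt p @ b"
  defines "f' \<equiv> f - scale (LC lt f * inverse (LC lt p)) (mon a * p * mon b)"
  shows "f' = f - scale (LC lt f) (shifted a (LM lt p) b)"
    and "k \<in> Poly_Mapping.keys f' \<Longrightarrow> lt k (LM lt f)"
proof -
  let ?c = "LC lt f * inverse (LC lt p)"
  have "scale (LC lt f) (shifted a (LM lt p) b) =
      scale (LC lt f) (mon a * scale (inverse (LC lt p)) p * mon b)"
    by (simp add: shifted_def normed_LM assms(2))
  also have "\<dots> = Poly_Mapping.single a ?c * p * mon b"
    by (simp add: mult.assoc[symmetric] single_mult_single)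
  finally have t: "scale (LC lt f) (shifted a (LM lt p) b) = Poly_Mapping.single a ?c * p * mon b" .
  have "scale ?c (mon a * p * mon b) = Poly_Mapping.single a ?c * p * mon b"
    by (simp add: mult.assoc[symmetric] single_mult_single)
  then show eq: "f' = f - scale (LC lt f) (shifted a (LM lt p) b)"
    by (simp add: f'_def t)
  assume k: "k \<in> Poly_Mapping.keys f'"
  have p: "p \<noteq> 0" using assms(2) zero_notin by blast
  have c: "?c \<noteq> 0"
    using LC_nonzero[OF assms(2)] LM_in_keys[OF adm assms(1)] by (simp add: LC_def in_keys_iff)
  note LM = LM_sandwich[OF adm p c, of a b]
  have "Poly_Mapping.lookup (Poly_Mapping.single a ?c * p * mon b) (LM lt f) = ?c * LC lt p"
    using LM(1,2) assms(3) by (simp only: LC_def)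
  then have "Poly_Mapping.lookup f' (LM lt f) = 0"
    using LC_nonzero[OF assms(2)] unfolding eq t lookup_minus by (simp add: LC_def)
  then have "k \<noteq> LM lt f" using k by (auto simp: in_keys_iff)
  moreover have "k \<in> Poly_Mapping.keys f \<or>
      k \<in> Poly_Mapping.keys (Poly_Mapping.single a ?c * p * mon b)"
    using k keys_diff[of f "Poly_Mapping.single a ?c * p * mon b"] by (auto simp: eq t in_keys_iff lookup_minus)
  ultimately show "lt k (LM lt f)"
    using less_LM[OF adm, of k] LM(1) assms(3) by metis
qed

lemma remove_LM:
  assumes "k \<in> Poly_Mapping.keys (f - Poly_Mapping.single (LM lt f) (LC lt f))"
  shows "lt k (LM lt f)"
proof -
  have "k \<noteq> LM lt f" using assms by (auto simp: in_keys_iff lookup_minus LC_def)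
  moreover have "k \<in> Poly_Mapping.keys f"
    using assms \<open>k \<noteq> LM lt f\<close> by (auto simp: in_keys_iff lookup_minus lookup_single)
  ultimately show ?thesis using less_LM[OF adm] by blast
qed

lemma inv_red_step_keys:
  assumes "inv_red_step I lt G (f, r) (f', r')" "k \<in> Poly_Mapping.keys f'"
  shows "lt k (LM lt f)"
  using assms by (cases rule: inv_red_step.cases) (use cancel_LM(2) remove_LM in blast)+

text \<open>A reduction subtracts one multiple whose leading monomial is that of \<open>f\<close>,
  hence under \<open>w\<close>; moving a term to the remainder keeps \<open>f + r\<close>.\<close>

lemma inv_red_step_cong_below:
  assumes "inv_red_step I lt G (f, r) (f', r')" "\<And>k. k \<in> Poly_Mapping.keys f \<Longrightarrow> lt k w"
  shows "cong_below w (f + r) (f' + r')"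
  using assms(1)
proof (cases rule: inv_red_step.cases)
  case (reduce p v1 v2)
  have "lt (v1 @ LM lt p @ v2) w" using assms(2) LM_in_keys[OF adm reduce(3)] reduce(5) by simp
  then have "scale (LC lt f) (shifted v1 (LM lt p) v2) \<in> below w"
    using reduce(4) by (intro shifted_below) auto
  moreover have "f + r - (f' + r') = scale (LC lt f) (shifted v1 (LM lt p) v2)"
    using cancel_LM(1)[OF reduce(3,4,5)] reduce(1,2) by simp
  ultimately show ?thesis by (simp add: cong_below_def)
qed (simp add: cong_below_def below.zero)

lemma inv_red_steps_cong_below:
  assumes "(inv_red_step I lt G)\<^sup>*\<^sup>* (f, r) (f', r')" "\<And>k. k \<in> Poly_Mapping.keys f \<Longrightarrow> lt k w"
  shows "cong_below w (f + r) (f' + r')"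
  using assms
proof (induction "(f, r)" arbitrary: f r rule: converse_rtranclp_induct)
  case base
  show ?case by (rule cong_below_refl)
next
  case (step z)
  obtain f1 r1 where z: "z = (f1, r1)" by fastforce
  note step1 = step.hyps(1)[unfolded z]
  have "f \<noteq> 0" using step1 by (cases rule: inv_red_step.cases) auto
  then have "lt (LM lt f) w" using LM_in_keys[OF adm] step.prems by blast
  then have "lt k w" if "k \<in> Poly_Mapping.keys f1" for k
    using inv_red_step_keys[OF step1 that] admissible_trans[OF adm] by blast
  then have "cong_below w (f1 + r1) (f' + r')" by (rule step.hyps(3)[OF z])
  with inv_red_step_cong_below[OF step1 step.prems] show ?case by (rule cong_below_trans)
qed

text \<open>The remainder only receives leading terms of current polynomials, all under
  \<open>w\<close>. So a term moved at \<open>w\<close> earlier can never vanish again.\<close>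

lemma inv_red_steps_remainder:
  assumes "(inv_red_step I lt G)\<^sup>*\<^sup>* (f, r) (f', r')" "\<And>k. k \<in> Poly_Mapping.keys f \<Longrightarrow> lt k w"
  shows "Poly_Mapping.lookup r' w = Poly_Mapping.lookup r w"
  using assms
proof (induction "(f, r)" arbitrary: f r rule: converse_rtranclp_induct)
  case (step z)
  obtain f1 r1 where z: "z = (f1, r1)" by fastforce
  note step1 = step.hyps(1)[unfolded z]
  have "f \<noteq> 0" using step1 by (cases rule: inv_red_step.cases) auto
  then have LM: "lt (LM lt f) w" using LM_in_keys[OF adm] step.prems by blast
  then have "lt k w" if "k \<in> Poly_Mapping.keys f1" for k
    using inv_red_step_keys[OF step1 that] admissible_trans[OF adm] by blast
  then have "Poly_Mapping.lookup r' w = Poly_Mapping.lookup r1 w" by (rule step.hyps(3)[OF z])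
  moreover have "LM lt f \<noteq> w" using LM admissible_irrefl[OF adm] by blast
  then have "Poly_Mapping.lookup r1 w = Poly_Mapping.lookup r w"
    by (cases rule: inv_red_step.cases[OF step1]) (auto simp: lookup_add lookup_single)
  ultimately show ?case by simp
qed simp

text \<open>Later steps stay under the leading monomial of \<open>f\<close>, so only the first one
  touches it. That step cannot be a move, as the moved term would survive in the final
  remainder.\<close>

lemma inv_reduces_to_zero_first_step:
  assumes "inv_reduces_to_zero I lt G f" "f \<noteq> 0"
  obtains v1 u v2 where "u \<in> U" "LM lt f = v1 @ u @ v2" "inv_divides_at (I U) v1 u v2"
    "cong_below (LM lt f) f (scale (LC lt f) (shifted v1 u v2))"
proof -
  from assms obtain f1 r1 where
    step1: "inv_red_step I lt G (f, 0) (f1, r1)" and steps: "(inv_red_step I lt G)\<^sup>*\<^sup>* (f1, r1) (0, 0)"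
    unfolding inv_reduces_to_zero_def by (metis converse_rtranclpE prod.exhaust prod.inject)
  note keys = inv_red_step_keys[OF step1]
  show thesis
    using step1
  proof (cases rule: inv_red_step.cases)
    case (reduce p v1 v2)
    have "cong_below (LM lt f) f1 0"
      using inv_red_steps_cong_below[OF steps keys] reduce(2) by simp
    then have "cong_below (LM lt f) f (scale (LC lt f) (shifted v1 (LM lt p) v2))"
      using cancel_LM(1)[OF reduce(3,4,5)] reduce(1) by (simp add: cong_below_def)
    then show thesis using reduce(4,5,6) by (intro that[of "LM lt p" v1 v2]) simp_all
  next
    case move
    have "Poly_Mapping.lookup r1 (LM lt f) = 0"
      using inv_red_steps_remainder[OF steps keys] by simp
    then have "LC lt f = 0" using move(2) by simp
    then show ?thesis using LM_in_keys[OF adm assms(2)] by (simp add: LC_def in_keys_iff)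
  qed
qed

lemma prolongation_cong:
  assumes "g \<in> G" "inv_reduces_to_zero I lt G (mon a * g * mon b)"
  obtains v1 u v2 where "u \<in> U" "a @ LM lt g @ b = v1 @ u @ v2" "inv_divides_at (I U) v1 u v2"
    "cong_below (a @ LM lt g @ b) (shifted a (LM lt g) b) (shifted v1 u v2)"
proof -
  have "g \<noteq> 0" using assms(1) zero_notin by blast
  note LM = LM_sandwich[OF adm this one_neq_zero, of a b]
  obtain u v1 v2 where u: "u \<in> U" "a @ LM lt g @ b = v1 @ u @ v2" "inv_divides_at (I U) v1 u v2"
    and cong: "cong_below (a @ LM lt g @ b) (mon a * g * mon b) (scale (LC lt g) (shifted v1 u v2))"
    by (rule inv_reduces_to_zero_first_step[OF assms(2) LM(3), unfolded LM(1,2)])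
      (rule that, simp_all)
  let ?c = "inverse (LC lt g)"
  have c: "?c * LC lt g = 1" using LC_nonzero[OF assms(1)] by simp
  have "scale ?c (mon a * g * mon b - scale (LC lt g) (shifted v1 u v2)) \<in> below (a @ LM lt g @ b)"
    using cong unfolding cong_below_def by (rule below_scale)
  moreover have "scale ?c (mon a * g * mon b) = shifted a (LM lt g) b"
    by (simp add: shifted_def normed_LM assms(1) mult.assoc[symmetric] single_mult_single)
  moreover have "scale ?c (scale (LC lt g) (shifted v1 u v2)) = shifted v1 u v2"
    by (simp add: mult.assoc[symmetric] single_mult_single c)
  ultimately have "cong_below (a @ LM lt g @ b) (shifted a (LM lt g) b) (shifted v1 u v2)"
    by (simp add: cong_below_def right_diff_distrib)
  with u show thesis by (rule that)
qed

end

section \<open>Confluence\<close>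

locale left_overlap_basis = ordered_generators lt G
  for lt :: "'v::{finite, linorder} word \<Rightarrow> 'v word \<Rightarrow> bool"
    and G :: "('v, 'k::field) ncpoly set" +
  assumes finite_G: "finite G"
    and basis: "locally_involutive_basis left_overlap_division lt G"
begin

abbreviation left_vars :: "'v word \<Rightarrow> 'v set" where
  "left_vars \<equiv> left_mult (left_overlap_division U)"

abbreviation right_vars :: "'v word \<Rightarrow> 'v set" where
  "right_vars \<equiv> right_mult (left_overlap_division U)"

lemma nonsuffix: "v \<in> U \<Longrightarrow> a @ v @ x # b \<in> U \<Longrightarrow> x \<notin> right_vars v"
  by (rule left_overlap_division_nonsuffix[OF finite_imageI[OF finite_G]])

lemma suffix: "v \<in> U \<Longrightarrow> a @ y # v \<in> U \<Longrightarrow> y \<notin> left_vars v"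
  by (rule left_overlap_division_suffix[OF finite_imageI[OF finite_G]])

lemma overlap:
  "a @ y # c \<in> U \<Longrightarrow> c @ x # b \<in> U \<Longrightarrow> c \<noteq> [] \<Longrightarrow>
    x \<notin> right_vars (a @ y # c) \<or> y \<notin> left_vars (c @ x # b)"
  by (rule left_overlap_division_overlap[OF finite_imageI[OF finite_G]])

lemma right_prolongation:
  assumes "u \<in> U" "x \<notin> right_vars u"
  obtains l v where "v \<in> U" "u @ [x] = l @ v"
    "\<forall>a b. cong_below (a @ u @ x # b) (shifted a u (x # b)) (shifted (a @ l) v b)"
proof -
  obtain g where g: "g \<in> G" "u = LM lt g" using assms(1) by blast
  have red: "inv_reduces_to_zero left_overlap_division lt G (mon [] * g * mon [x])"
    using basis assms(2) g unfolding locally_involutive_basis_def by simp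
  obtain v l r where v: "v \<in> U" "u @ [x] = l @ v @ r"
    and div: "inv_divides_at (left_overlap_division U) l v r"
    and cong: "cong_below (u @ [x]) (shifted [] u [x]) (shifted l v r)"
    by (rule prolongation_cong[OF g(1) red]) (rule that, simp_all add: g(2))
  \<comment> \<open>Otherwise \<open>v\<close> lies inside \<open>u\<close>. If a letter of
    \<open>u\<close> follows \<open>v\<close>, or else precedes it, thinness makes that letter
    multiplicative against \<open>nonsuffix\<close> or \<open>suffix\<close>; if
    \<open>v = u\<close>, then \<open>x\<close> would be right multiplicative for
    \<open>u\<close>.\<close>
  have "r = []"
  proof (cases r rule: rev_cases)
    case (snoc r' z)
    then have u: "u = l @ v @ r'" "z = x" using v(2) by auto
    show ?thesis
    proof (cases r')
      case Nil
      then have "x \<in> right_vars v" using div snoc u by (simp add: inv_divides_at_def)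
      then have "l \<noteq> []" using u Nil assms(2) by auto
      then have "last l \<in> left_vars v" using div by (simp add: inv_divides_at_def)
      moreover have "butlast l @ last l # v \<in> U"
        using u Nil \<open>l \<noteq> []\<close> assms(1) append_butlast_last_id[of l]
        by (metis append.assoc append_Cons append_Nil append_Nil2)
      ultimately show ?thesis using suffix[OF v(1)] by blast
    next
      case (Cons y ys)
      then have "y \<in> right_vars v" using div snoc by (simp add: inv_divides_at_def)
      then show ?thesis using nonsuffix[OF v(1), of l y ys] u Cons assms(1) by simp
    qed
  qed simp
  then have "cong_below (a @ u @ x # b) (shifted a u (x # b)) (shifted (a @ l) v b)" for a b
    using cong_below_shifted[OF cong, of a b] by simp
  with v \<open>r = []\<close> show thesis by (intro that[of v l]) simp_all
qed

text \<open>The multiplicativity of the letter after \<open>v\<close> is kept because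
  \<open>cong_below_suffix_whole\<close> uses it to exclude that \<open>v\<close> stops before the
  end of the word.\<close>

lemma left_prolongation:
  assumes "u \<in> U" "y \<notin> left_vars u"
  obtains v r where "v \<in> U" "y # u = v @ r" "r \<noteq> [] \<longrightarrow> hd r \<in> right_vars v"
    "\<forall>a b. cong_below (a @ y # u @ b) (shifted (a @ [y]) u b) (shifted a v (r @ b))"
proof -
  obtain g where g: "g \<in> G" "u = LM lt g" using assms(1) by blast
  have red: "inv_reduces_to_zero left_overlap_division lt G (mon [y] * g * mon [])"
    using basis assms(2) g unfolding locally_involutive_basis_def by simp
  obtain v l r where v: "v \<in> U" "y # u = l @ v @ r"
    and div: "inv_divides_at (left_overlap_division U) l v r"
    and cong: "cong_below (y # u) (shifted [y] u []) (shifted l v r)"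
    by (rule prolongation_cong[OF g(1) red]) (rule that, simp_all add: g(2))
  \<comment> \<open>Otherwise \<open>v\<close> lies inside \<open>u\<close> again. A letter of
    \<open>u\<close> after \<open>v\<close> contradicts \<open>nonsuffix\<close>; if
    \<open>v\<close> is a proper suffix of \<open>u\<close>, the letter before it contradicts
    \<open>suffix\<close>, and for \<open>v = u\<close> that letter is \<open>y\<close>.\<close>
  have "l = []"
  proof (cases l)
    case (Cons z l')
    then have u: "u = l' @ v @ r" "z = y" using v(2) by auto
    show ?thesis
    proof (cases r)
      case Nil
      have "last l \<in> left_vars v" using div Cons by (simp add: inv_divides_at_def)
      show ?thesis
      proof (cases l' rule: rev_cases)
        case Nil
        then show ?thesis using \<open>last l \<in> left_vars v\<close> Cons u \<open>r = []\<close> assms(2) by simp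
      next
        case (snoc l'' x)
        then show ?thesis
          using suffix[OF v(1), of l'' x] \<open>last l \<in> left_vars v\<close> Cons u \<open>r = []\<close> assms(1) by simp
      qed
    next
      case (Cons x r')
      then have "x \<in> right_vars v" using div by (simp add: inv_divides_at_def)
      then show ?thesis using nonsuffix[OF v(1), of l' x r'] u Cons assms(1) by simp
    qed
  qed simp
  then have "cong_below (a @ y # u @ b) (shifted (a @ [y]) u b) (shifted a v (r @ b))" for a b
    using cong_below_shifted[OF cong, of a b] by simp
  with v div \<open>l = []\<close> show thesis by (intro that[of v r]) (simp_all add: inv_divides_at_def)
qed

text \<open>By \<open>suffix\<close> the letter before \<open>u\<close> is nonmultiplicative, so
  \<open>u\<close> has a left prolongation. The divisor it yields starts at that letter and must
  reach the end of \<open>w\<close>: a letter of \<open>w\<close> after it would be right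
  multiplicative, against \<open>nonsuffix\<close>.\<close>

lemma cong_below_suffix_whole:
  assumes "w \<in> U" "w = a @ u" "u \<in> U"
  shows "cong_below w (shifted a u []) (shifted [] w [])"
  using assms(2,3)
proof (induction a arbitrary: u rule: rev_induct)
  case Nil
  then show ?case by (simp add: cong_below_refl)
next
  case (snoc y a)
  have "y \<notin> left_vars u" using suffix[of u a y] snoc.prems assms(1) by simp
  then obtain v r where v: "v \<in> U" "y # u = v @ r" "r \<noteq> [] \<longrightarrow> hd r \<in> right_vars v"
    and cong: "\<forall>a b. cong_below (a @ y # u @ b) (shifted (a @ [y]) u b) (shifted a v (r @ b))"
    by (rule left_prolongation[OF snoc.prems(2)]) (rule that)
  have "r = []"
  proof (rule ccontr)
    assume "r \<noteq> []"
    then have "a @ v @ hd r # tl r \<in> U" using v(2) snoc.prems(1) assms(1) by simp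
    then show False using nonsuffix[OF v(1)] v(3) \<open>r \<noteq> []\<close> by blast
  qed
  then have "cong_below w (shifted a v []) (shifted [] w [])"
    using v snoc.prems(1) by (intro snoc.IH) simp_all
  moreover have "cong_below w (shifted (a @ [y]) u []) (shifted a v [])"
    using cong[rule_format, of a "[]"] \<open>r = []\<close> snoc.prems(1) by simp
  ultimately show ?case by (rule cong_below_trans[rotated])
qed

text \<open>While \<open>b\<close> is nonempty, \<open>nonsuffix\<close> provides a right
  prolongation, which moves the right end of the occurrence by one letter. The left end may move
  too, which is why \<open>a\<close> is arbitrary.\<close>

lemma cong_below_whole:
  assumes "w \<in> U" "w = a @ u @ b" "u \<in> U"
  shows "cong_below w (shifted a u b) (shifted [] w [])"
  using assms(2,3)
proof (induction b arbitrary: a u)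
  case Nil
  then show ?case using cong_below_suffix_whole[OF assms(1)] by simp
next
  case (Cons x b)
  have "x \<notin> right_vars u" using nonsuffix[of u a x b] Cons.prems assms(1) by simp
  then obtain l v where v: "v \<in> U" "u @ [x] = l @ v"
    and cong: "\<forall>a b. cong_below (a @ u @ x # b) (shifted a u (x # b)) (shifted (a @ l) v b)"
    by (rule right_prolongation[OF Cons.prems(2)]) (rule that)
  have "w = (a @ l) @ v @ b" using Cons.prems(1) v(2) by (metis append.assoc append_Cons append_Nil)
  then have "cong_below w (shifted (a @ l) v b) (shifted [] w [])" using v(1) by (rule Cons.IH)
  moreover have "cong_below w (shifted a u (x # b)) (shifted (a @ l) v b)"
    using cong[rule_format, of a b] Cons.prems(1) by simp
  ultimately show ?case by (rule cong_below_trans[rotated])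
qed

text \<open>
  By the overlap rule one of two overlapping divisors \<open>u\<close>, \<open>v\<close> has a prolongation towards the
  other. Reducing it either lengthens this divisor or leads to a divisor that misses the same end
  of \<open>w\<close> as the other one, so that the congruence is inherited from a shorter word.
\<close>

lemma cong_below_overlap:
  assumes "w \<notin> U" and shorter: "\<And>w'. length w' < length w \<Longrightarrow> confluent_at w'"
    and "w = u @ b" "w = a @ v" "u \<in> U" "v \<in> U"
  shows "cong_below w (shifted [] u b) (shifted a v [])"
  using assms(3-)
\<comment> \<open>\<open>a\<close> and \<open>b\<close> are the parts of \<open>w\<close> missed by
  \<open>v\<close> and by \<open>u\<close>; their total length drops when one of the divisors
  grows.\<close>
proof (induction "length a + length b" arbitrary: u a b v rule: less_induct)
  case less
  note w = less.prems(1,2) and uv = less.prems(3,4)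
  show ?case
  proof (cases "length u \<le> length a")
    case True
    then obtain m where "a = u @ m" using w by (metis append_eq_append_conv_if append_take_drop_id)
    then show ?thesis using disjoint_cong[OF uv, of "[]" m "[]"] w by simp
  next
    case False
    obtain c where c: "u = a @ c" "v = c @ b" "c \<noteq> []"
      using w False by (auto simp: append_eq_append_conv2)
    \<comment> \<open>An empty \<open>a\<close> or \<open>b\<close> would make \<open>w\<close>
      itself a leading monomial.\<close>
    have "a \<noteq> []" "b \<noteq> []" using w uv assms(1) by (metis append_Nil, metis append_Nil2)
    then obtain a' y x b' where a: "a = a' @ [y]" and b: "b = x # b'"
      by (metis append_butlast_last_id list.exhaust)
    consider "x \<notin> right_vars u" | "y \<notin> left_vars v"
      using overlap[of a' y c x b'] uv c a b by auto
    then show ?thesis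
    proof cases
      case 1
      then obtain l u' where u': "u' \<in> U" "u @ [x] = l @ u'"
        and cong: "\<forall>a b. cong_below (a @ u @ x # b) (shifted a u (x # b)) (shifted (a @ l) u' b)"
        by (rule right_prolongation[OF uv(1)]) (rule that)
      have w': "w = l @ u' @ b'" using w(1) b u'(2) by (metis append.assoc append_Cons append_Nil)
      have "cong_below w (shifted l u' b') (shifted a v [])"
      proof (cases l)
        case Nil
        show ?thesis
          unfolding Nil by (rule less.hyps) (use w w' uv u' b Nil in auto)
      next
        case (Cons z l')
        then have "z # l' @ u' @ b' = a @ v" using w(2) w' by simp
        then have "a = z # tl a" and eq: "l' @ u' @ b' = tl a @ v @ []"
          using \<open>a \<noteq> []\<close> by (cases a; simp)+
        have "cong_below (l' @ u' @ b') (shifted l' u' b') (shifted (tl a) v [])"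
          by (rule confluent_atD[OF shorter u'(1) uv(2) refl eq]) (simp add: w' Cons)
        from cong_below_shifted[OF this, of "[z]" "[]"] show ?thesis
          using w' Cons \<open>a = z # tl a\<close> by simp
      qed
      moreover have "cong_below w (shifted [] u b) (shifted l u' b')"
        using cong[rule_format, of "[]" b'] b w(1) by simp
      ultimately show ?thesis by (rule cong_below_trans[rotated])
    next
      case 2
      then obtain v' r where v': "v' \<in> U" "y # v = v' @ r"
        and cong: "\<forall>a b. cong_below (a @ y # v @ b) (shifted (a @ [y]) v b) (shifted a v' (r @ b))"
        by (rule left_prolongation[OF uv(2)]) (rule that)
      have w': "w = a' @ v' @ r" using w(2) a v'(2) by simp
      have "cong_below w (shifted [] u b) (shifted a' v' r)"
      proof (cases r rule: rev_cases)
        case Nil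
        show ?thesis
          unfolding Nil by (rule less.hyps) (use w w' uv v' a Nil in auto)
      next
        case (snoc r' z)
        then have "(a' @ v' @ r') @ [z] = u @ b" using w(1) w' by simp
        then have b': "b = butlast b @ [z]" and eq: "a' @ v' @ r' = [] @ u @ butlast b"
          using \<open>b \<noteq> []\<close> by (cases b rule: rev_cases; simp)+
        have "cong_below (a' @ v' @ r') (shifted [] u (butlast b)) (shifted a' v' r')"
          by (rule confluent_atD[OF shorter uv(1) v'(1) eq refl]) (simp add: w' snoc)
        from cong_below_shifted[OF this, of "[]" "[z]"] show ?thesis
          using w' snoc b' by simp
      qed
      moreover have "cong_below w (shifted a v []) (shifted a' v' r)"
        using cong[rule_format, of a' "[]"] a w(2) by simp
      ultimately show ?thesis by (meson cong_below_sym cong_below_trans)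
    qed
  qed
qed

lemma confluent_at: "confluent_at w"
proof (induction w rule: length_induct)
  case (1 w)
  then have shorter: "\<And>w'. length w' < length w \<Longrightarrow> confluent_at w'" by blast
  show ?case
  proof (cases "w \<in> U")
    case True
    then show ?thesis
      unfolding confluent_at_def
      by (intro allI impI) (rule cong_below_trans[OF cong_below_whole cong_below_sym[OF cong_below_whole]])
  next
    case False
    note overlap = cong_below_overlap[OF False shorter]
    show ?thesis
      unfolding confluent_at_def
    proof (intro allI impI)
      fix l u r l' u' r'
      assume u: "u \<in> U" "u' \<in> U" and w: "w = l @ u @ r" "w = l' @ u' @ r'"
      \<comment> \<open>Both occurrences miss the first letter, both miss the last, one is a prefix
        and the other a suffix, or one is all of \<open>w\<close>, which contradicts
        \<open>w \<notin> U\<close>.\<close>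
      consider x m y m' where "l = x # m" "l' = y # m'"
        | x m y m' where "r = m @ [x]" "r' = m' @ [y]"
        | "l = []" "r' = []" | "l' = []" "r = []" | "l = []" "r = []" | "l' = []" "r' = []"
        by (metis list.exhaust rev_exhaust)
      then show "cong_below w (shifted l u r) (shifted l' u' r')"
      proof cases
        case 1
        then have "x = y" "m @ u @ r = m' @ u' @ r'" using w by auto
        then have "cong_below (m @ u @ r) (shifted m u r) (shifted m' u' r')"
          using w 1 u by (intro confluent_atD[OF shorter]) auto
        from cong_below_shifted[OF this, of "[x]" "[]"] show ?thesis using w 1 \<open>x = y\<close> by simp
      next
        case 2
        then have "(l @ u @ m) @ [x] = (l' @ u' @ m') @ [y]" using w by simp
        then have "x = y" "l @ u @ m = l' @ u' @ m'" by auto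
        then have "cong_below (l @ u @ m) (shifted l u m) (shifted l' u' m')"
          using w 2 u by (intro confluent_atD[OF shorter]) auto
        from cong_below_shifted[OF this, of "[]" "[x]"]
        have "cong_below w (shifted l u (m @ [x])) (shifted l' u' (m' @ [x]))"
          using w(1) 2 by simp
        then show ?thesis using 2 \<open>x = y\<close> by simp
      next
        case 3
        then show ?thesis using overlap[of u r l' u'] u w by simp
      next
        case 4
        then show ?thesis using cong_below_sym[OF overlap[of u' r' l u]] u w by simp
      qed (use w u False in auto)
    qed
  qed
qed

end

section \<open>The generated ideal\<close>

context ordered_generators
begin

text \<open>All sets \<open>below w\<close> together form a two-sided ideal containing
  \<open>G\<close>.\<close>

lemma ideal_generated_below:
  assumes "f \<in> ideal_generated G"
  shows "\<exists>w. f \<in> below w"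
proof -
  let ?J = "\<Union>w. below w"
  \<comment> \<open>Lengthening a word never makes it smaller, so \<open>v @ w\<close> is a common
    bound for \<open>v\<close> and \<open>w\<close>.\<close>
  have bigger: "f \<in> below (a @ w @ b)" if "f \<in> below w" for f a w b
    using below_mono[OF that] that admissible_mono[OF adm admissible_Nil[OF adm], of b w "[]"]
      below_mono[of f "w @ b" "a @ w @ b"]
      admissible_mono[OF adm admissible_Nil[OF adm], of a "[]" "w @ b"]
    by (cases "a = []"; cases "b = []") simp_all
  have add: "f + g \<in> ?J" if fg: "f \<in> ?J" "g \<in> ?J" for f g
  proof -
    obtain v w where "f \<in> below v" "g \<in> below w" using fg by blast
    then have "f + g \<in> below (v @ w)"
      using bigger[of f v "[]" w] bigger[of g w v "[]"] by (simp add: below_add)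
    then show ?thesis by blast
  qed
  have sum: "sum h A \<in> ?J" if "\<And>i. i \<in> A \<Longrightarrow> h i \<in> ?J" for h :: "'v word \<Rightarrow> _" and A
    using that by (induction A rule: infinite_finite_induct) (use add below.zero in auto)
  have mult: "p * f \<in> ?J" "f * p \<in> ?J" if f: "f \<in> ?J" for f p
  proof -
    obtain w where w: "f \<in> below w" using f by blast
    have l: "Poly_Mapping.single a c * f \<in> ?J" for a c
      using below_sandwich[OF w, of a c "[]"] by auto
    have r: "f * Poly_Mapping.single a c \<in> ?J" for a c
      using below_sandwich[OF w, of "[]" c a] unfolding mult_single_eq_scale[of f a] by auto
    show "p * f \<in> ?J"
      by (subst ncpoly_sum_terms[of p], unfold sum_distrib_right) (intro sum l)
    show "f * p \<in> ?J"
      by (subst ncpoly_sum_terms[of p], unfold sum_distrib_left) (intro sum r)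
  qed
  have zero: "0 \<in> ?J" using below.zero by blast
  have "two_sided_ideal ?J"
    unfolding two_sided_ideal_def by (intro conjI ballI allI zero add mult)
  moreover have "G \<subseteq> ?J"
  proof
    fix g assume g: "g \<in> G"
    \<comment> \<open>The bound has to be strict, so an arbitrary letter is appended to the leading
      monomial.\<close>
    have "lt ([] @ LM lt g @ []) (LM lt g @ [undefined])"
      using admissible_mono[OF adm admissible_Nil[OF adm], of "[undefined]" "LM lt g" "[]"] by simp
    then have "scale (LC lt g) (shifted [] (LM lt g) []) \<in> below (LM lt g @ [undefined])"
      using g by (intro shifted_below) auto
    then show "g \<in> ?J" using eq_scale_normed[OF g] by (auto simp: shifted_def)
  qed
  ultimately have "ideal_generated G \<subseteq> ?J"
    unfolding ideal_generated_def by (rule hull_minimal[rotated])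
  then show ?thesis using assms by blast
qed

end

text \<open>Every word divides itself involutively with empty cofactors, whatever the division; two
  elements with one leading monomial would thus violate autoreducedness.\<close>

lemma autoreduced_inj_LM:
  assumes "admissible lt" "0 \<notin> G" "autoreduced I lt G"
  shows "inj_on (LM lt) G"
proof (rule inj_onI, rule ccontr)
  fix p q assume *: "p \<in> G" "q \<in> G" "LM lt p = LM lt q" "p \<noteq> q"
  then have "LM lt p \<in> Poly_Mapping.keys p" using LM_in_keys[OF assms(1)] assms(2) by metis
  then have "\<not> inv_divides (I (LM lt ` G)) (LM lt q) (LM lt p)"
    using assms(3) *(1,2,4) unfolding autoreduced_def by (metis DiffI singletonD)
  moreover have "inv_divides (I (LM lt ` G)) (LM lt q) (LM lt q)"
    by (auto simp: inv_divides_def inv_divides_at_def intro: exI[of _ "[]"])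
  ultimately show False using *(3) by simp
qed

theorem proposition5p5p32:
  fixes lt :: "'v::{finite, linorder} word \<Rightarrow> 'v word \<Rightarrow> bool"
    and G :: "('v, 'k::field) ncpoly set"
  assumes "admissible lt"
    and "finite G"
    and "0 \<notin> G"
    and "locally_involutive_basis left_overlap_division lt G"
  shows "groebner_basis lt G (ideal_generated G)"
proof -
  interpret left_overlap_basis lt G
  proof
    show "inj_on (LM lt) G"
      using assms by (intro autoreduced_inj_LM) (auto simp: locally_involutive_basis_def)
  qed fact+
  show ?thesis
    unfolding groebner_basis_def
  proof (intro conjI ballI impI refl)
    fix f assume f: "f \<in> ideal_generated G" "f \<noteq> 0"
    obtain w where "f \<in> below w" using ideal_generated_below[OF f(1)] by blast
    then have "\<exists>g\<in>G. \<exists>l r. LM lt f = l @ LM lt g @ r"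
      by (rule confluent_LM[OF confluent_at _ f(2)])
    then show "\<exists>g\<in>G. g \<noteq> 0 \<and> (\<exists>l r. LM lt f = l @ LM lt g @ r)"
      using assms(3) by metis
  qed
qed

end
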